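(* Let $n,N,d\in\mathbb{N}$ be integers with $d\ge 2$ and $N\le n^d$. Let $$T_1=\sum_{i_1=1}^{n}\cdots\sum_{i_d=1}^{n} v^1_{i_1}\otimes\cdots\otimes v^d_{i_d}\otimes v^{d+1}_{i_1,\dots,i_d}\in V_1\otimes\cdots\otimes V_{d+1},$$ where $V_p=\mathbb{C}^n$ has basis $\{v^p_i:1\le i\le n\}$ for $p=1,\dots,d$, and $V_{d+1}=\mathbb{C}^{n^d}$ has basis $\{v^{d+1}_{i_1,\dots,i_d}:1\le i_p\le n\}$. Let $$T_2=\sum_{j=1}^{N} w^1_j\otimes w^2_j\otimes w^3\otimes\cdots\otimes w^{d+1}\in W_1\otimes\cdots\otimes W_{d+1},$$ where $W_p=\mathbb{C}^N$ has basis $\{w^p_j:1\le j\le N\}$ for $p=1,2$, and $W_p=\mathbb{C}^1$ is spanned by $w^p$ for $p=3,\dots,d+1$. Then $$\underline{\mathrm{R}}(T_1)=n^d,\qquad \underline{\mathrm{R}}(T_2)=N,$$ and $$\underline{\mathrm{R}}(T_1\oplus T_2)\le n^d+2n^{d-1}+n^2(n+1)^{d-3}+1=n^d+\mathcal{O}(n^{d-1}),$$ where the $\mathcal{O}$ is for fixed $d$ and $n\to\infty$.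
   Context: All vector spaces are finite dimensional over $\mathbb{C}$. For a tensor $T\in V_1\otimes\cdots\otimes V_k$, the tensor rank $\mathrm{R}(T)$ is the least $r$ such that $T=\sum_{i=1}^r v_1^{(i)}\otimes\cdots\otimes v_k^{(i)}$ with $v_j^{(i)}\in V_j$. The border rank $\underline{\mathrm{R}}(T)$ is the least $r$ such that $T=\lim_{\varepsilon\to0}T_\varepsilon$ (Euclidean topology) for tensors $T_\varepsilon\in V_1\otimes\cdots\otimes V_k$ with $\mathrm{R}(T_\varepsilon)=r$ for $\varepsilon\ne0$. For $T\in V_1\otimes\cdots\otimes V_k$ and $S\in W_1\otimes\cdots\otimes W_k$, the direct sum $T\oplus S$ is the tensor $T+S\in (V_1\oplus W_1)\otimes\cdots\otimes(V_k\oplus W_k)$, where $V_j,W_j$ are regarded as the two summands of $V_j\oplus W_j$. *)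

theory Defs
  imports "HOL-Analysis.Analysis" "HOL-Library.Landau_Symbols"
begin

text \<open>
  Every space is given with a basis: for a finite index set \<open>A\<close>, the space with basis indexed by
  \<open>A\<close> consists of the complex-valued functions vanishing off \<open>A\<close>. The factors of a
  \<open>k\<close>-fold tensor product are numbered \<open>1, \<dots>, k\<close>, and \<open>I p\<close> is the index set of the basis of
  the \<open>p\<close>-th factor. A tensor is represented by its coordinates in the induced product basis, which
  is indexed by \<open>multi_indices k I\<close>.
\<close>

definition vectors :: "'i set \<Rightarrow> ('i \<Rightarrow> complex) set"
  where "vectors A = {v. \<forall>i. i \<notin> A \<longrightarrow> v i = 0}"

definition basis_vec :: "'i \<Rightarrow> 'i \<Rightarrow> complex"
  where "basis_vec i = (\<lambda>j. if j = i then 1 else 0)"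

definition multi_indices :: "nat \<Rightarrow> (nat \<Rightarrow> 'i set) \<Rightarrow> (nat \<Rightarrow> 'i) set"
  where "multi_indices k I = PiE {1..k} I"

definition tensors :: "nat \<Rightarrow> (nat \<Rightarrow> 'i set) \<Rightarrow> ((nat \<Rightarrow> 'i) \<Rightarrow> complex) set"
  where "tensors k I = {T. \<forall>m. m \<notin> multi_indices k I \<longrightarrow> T m = 0}"

definition simple_tensor ::
    "nat \<Rightarrow> (nat \<Rightarrow> 'i set) \<Rightarrow> (nat \<Rightarrow> 'i \<Rightarrow> complex) \<Rightarrow> (nat \<Rightarrow> 'i) \<Rightarrow> complex"
  where "simple_tensor k I v =
    (\<lambda>m. if m \<in> multi_indices k I then \<Prod>p\<in>{1..k}. v p (m p) else 0)"

definition tensor_rank :: "nat \<Rightarrow> (nat \<Rightarrow> 'i set) \<Rightarrow> ((nat \<Rightarrow> 'i) \<Rightarrow> complex) \<Rightarrow> nat"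
  where "tensor_rank k I T = (LEAST r. \<exists>v :: nat \<Rightarrow> nat \<Rightarrow> 'i \<Rightarrow> complex.
    (\<forall>i\<in>{1..r}. \<forall>p\<in>{1..k}. v i p \<in> vectors (I p)) \<and>
    T = (\<lambda>m. \<Sum>i\<in>{1..r}. simple_tensor k I (v i) m))"

definition tensor_dist ::
    "nat \<Rightarrow> (nat \<Rightarrow> 'i set) \<Rightarrow> ((nat \<Rightarrow> 'i) \<Rightarrow> complex) \<Rightarrow> ((nat \<Rightarrow> 'i) \<Rightarrow> complex) \<Rightarrow> real"
  where "tensor_dist k I T S = L2_set (\<lambda>m. cmod (T m - S m)) (multi_indices k I)"

text \<open>
  The approximating family is an arbitrary function of the complex parameter \<open>\<epsilon> \<noteq> 0\<close>.
\<close>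

definition border_rank :: "nat \<Rightarrow> (nat \<Rightarrow> 'i set) \<Rightarrow> ((nat \<Rightarrow> 'i) \<Rightarrow> complex) \<Rightarrow> nat"
  where "border_rank k I T = (LEAST r. \<exists>F :: complex \<Rightarrow> (nat \<Rightarrow> 'i) \<Rightarrow> complex.
    (\<forall>\<epsilon>. \<epsilon> \<noteq> 0 \<longrightarrow> F \<epsilon> \<in> tensors k I \<and> tensor_rank k I (F \<epsilon>) = r) \<and>
    ((\<lambda>\<epsilon>. tensor_dist k I (F \<epsilon>) T) \<longlongrightarrow> 0) (at 0))"

text \<open>
  The \<open>p\<close>-th factor of a direct sum has its basis indexed by the disjoint union
  \<open>I p <+> J p\<close>. Both tensors are first regarded as tensors in the larger space.
\<close>

definition sum_indices :: "(nat \<Rightarrow> 'i set) \<Rightarrow> (nat \<Rightarrow> 'j set) \<Rightarrow> nat \<Rightarrow> ('i + 'j) set"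
  where "sum_indices I J = (\<lambda>p. I p <+> J p)"

definition embed_left ::
    "nat \<Rightarrow> (nat \<Rightarrow> 'i set) \<Rightarrow> ((nat \<Rightarrow> 'i) \<Rightarrow> complex) \<Rightarrow> (nat \<Rightarrow> 'i + 'j) \<Rightarrow> complex"
  where "embed_left k I T = (\<lambda>m. if m \<in> multi_indices k (\<lambda>p. Inl ` I p)
    then T (\<lambda>p\<in>{1..k}. projl (m p)) else 0)"

definition embed_right ::
    "nat \<Rightarrow> (nat \<Rightarrow> 'j set) \<Rightarrow> ((nat \<Rightarrow> 'j) \<Rightarrow> complex) \<Rightarrow> (nat \<Rightarrow> 'i + 'j) \<Rightarrow> complex"
  where "embed_right k J S = (\<lambda>m. if m \<in> multi_indices k (\<lambda>p. Inr ` J p)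
    then S (\<lambda>p\<in>{1..k}. projr (m p)) else 0)"

definition direct_sum ::
    "nat \<Rightarrow> (nat \<Rightarrow> 'i set) \<Rightarrow> (nat \<Rightarrow> 'j set) \<Rightarrow> ((nat \<Rightarrow> 'i) \<Rightarrow> complex) \<Rightarrow>
      ((nat \<Rightarrow> 'j) \<Rightarrow> complex) \<Rightarrow> (nat \<Rightarrow> 'i + 'j) \<Rightarrow> complex"
  where "direct_sum k I J T S = (\<lambda>m. embed_left k I T m + embed_right k J S m)"

text \<open>
  The basis vector with index \<open>i\<close> of each of the first \<open>d\<close> factors is indexed by the one-element
  list \<open>[i]\<close>, so that these factors and the last one, whose basis is indexed by \<open>d\<close>-tuples, share
  an index type. List positions count from \<open>0\<close>, factors from \<open>1\<close>.
\<close>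

definition tuples :: "nat \<Rightarrow> nat \<Rightarrow> nat list set"
  where "tuples d n = {is. length is = d \<and> set is \<subseteq> {1..n}}"

definition V_indices :: "nat \<Rightarrow> nat \<Rightarrow> nat \<Rightarrow> nat list set"
  where "V_indices d n = (\<lambda>p. if p \<le> d then (\<lambda>i. [i]) ` {1..n} else tuples d n)"

definition T1 :: "nat \<Rightarrow> nat \<Rightarrow> (nat \<Rightarrow> nat list) \<Rightarrow> complex"
  where "T1 d n = (\<lambda>m. \<Sum>is\<in>tuples d n. simple_tensor (d + 1) (V_indices d n)
    (\<lambda>p. if p \<le> d then basis_vec [is ! (p - 1)] else basis_vec is) m)"

definition W_indices :: "nat \<Rightarrow> nat \<Rightarrow> nat set"
  where "W_indices N = (\<lambda>p. if p \<le> 2 then {1..N} else {1})"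

definition T2 :: "nat \<Rightarrow> nat \<Rightarrow> (nat \<Rightarrow> nat) \<Rightarrow> complex"
  where "T2 d N = (\<lambda>m. \<Sum>j\<in>{1..N}. simple_tensor (d + 1) (W_indices N)
    (\<lambda>p. if p \<le> 2 then basis_vec j else basis_vec 1) m)"

end

theory Submission imports Defs begin

text \<open>
  In the given bases \<open>T\<^sub>1\<close>, \<open>T\<^sub>2\<close> and their direct sum have all coordinates in \<open>{0, 1}\<close>: they are
  indicators of sets of multi-indices. This gives the bounds \<open>n ^ d\<close> and \<open>N\<close> from above, by counting.
  The bounds from below come from flattenings: separating the last factor of \<open>T\<^sub>1\<close>, or the first factor
  of \<open>T\<^sub>2\<close>, from the others turns the tensor into an identity matrix, and a matrix near the
  identity has full rank (\<open>border_rank_ge_identity_flattening\<close>).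

  The bound for the direct sum is a combinatorial degeneration of the structure tensor of the cyclic
  group of order \<open>R\<close>. Give every basis vector of every factor an integer exponent. The tensor whose
  coordinate at a multi-index is \<open>1\<close> if \<open>R\<close> divides the total exponent and \<open>0\<close> otherwise has rank at
  most \<open>R\<close>, being the average over the \<open>R\<close>-th roots of unity \<open>z\<close> of the product tensors with entries
  \<open>z\<close> to the exponent. Give every basis vector also an integer weight \<open>W\<close> and scale it by
  \<open>\<epsilon> powi W\<close>. If every multi-index with total exponent divisible by \<open>R\<close> has positive total weight,
  except those in a set \<open>S\<close> where the total weight is \<open>0\<close>, then for \<open>\<epsilon> \<rightarrow> 0\<close> only \<open>S\<close> survives, and
  the indicator of \<open>S\<close> has border rank at most \<open>R\<close> (\<open>border_rank_cyclic_degeneration\<close>).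

  For the direct sum, the basis vector \<open>i\<close> of \<open>V\<^sub>p\<close> (\<open>p \<le> d\<close>) gets the exponent \<open>i n ^ (d - p)\<close>, a digit
  in base \<open>n\<close> with digits \<open>1, \<dots>, n\<close>, and a basis vector of the last \<open>V\<close> gets minus the number
  with those digits; so the divisible multi-indices inside the \<open>V\<^sub>p\<close> are exactly those of \<open>T\<^sub>1\<close>. The
  basis vectors \<open>j\<close> of \<open>W\<^sub>1\<close> and \<open>W\<^sub>2\<close> get the opposite exponents \<open>e j\<close> and \<open>- e j\<close>, and the other \<open>W\<^sub>p\<close>
  get \<open>0\<close>; so the multi-indices of \<open>T\<^sub>2\<close> are divisible as well. Among the mixed multi-indices,
  those that end in the last \<open>V\<close> are removed because all \<open>W\<^sub>p\<close> with \<open>p \<le> d\<close> have positive weights. Those that end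
  in the last \<open>W\<close> have to be avoided, by the choice of \<open>e\<close>, when they use \<open>V\<^sub>1\<close> or \<open>V\<^sub>2\<close>; this
  excludes about \<open>2 n ^ (d - 1)\<close> exponents, and it is the reason for the second
  term of the bound. When they use both \<open>W\<^sub>1\<close> and \<open>W\<^sub>2\<close>, with indices \<open>j\<close> and \<open>j'\<close>, divisibility forces
  \<open>e j' = e j + s\<close>, where \<open>s \<ge> 0\<close> is the sum of the digits in the middle factors, and a weight that
  grows with \<open>e j' - e j\<close> removes all of them except those of \<open>T\<^sub>2\<close>. The middle digits are of low
  order: \<open>s\<close> is at most about \<open>n ^ (d - 2)\<close>, which is why it costs so little to make room for them.
\<close>

section \<open>Tensor rank and border rank\<close>

definition sum_of_simple ::
    "nat \<Rightarrow> (nat \<Rightarrow> 'i set) \<Rightarrow> nat \<Rightarrow> ((nat \<Rightarrow> 'i) \<Rightarrow> complex) \<Rightarrow> bool"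
  where "sum_of_simple k I r T \<longleftrightarrow> (\<exists>v :: nat \<Rightarrow> nat \<Rightarrow> 'i \<Rightarrow> complex.
    (\<forall>i\<in>{1..r}. \<forall>p\<in>{1..k}. v i p \<in> vectors (I p)) \<and>
    T = (\<lambda>m. \<Sum>i\<in>{1..r}. simple_tensor k I (v i) m))"

lemma tensor_rank_eq_Least: "tensor_rank k I T = (LEAST r. sum_of_simple k I r T)"
  by (simp add: tensor_rank_def sum_of_simple_def)

lemma tensor_rank_le: "sum_of_simple k I r T \<Longrightarrow> tensor_rank k I T \<le> r"
  by (simp add: tensor_rank_eq_Least Least_le)

lemma sum_of_simple_card:
  assumes "finite S" and "\<And>s p. s \<in> S \<Longrightarrow> p \<in> {1..k} \<Longrightarrow> v s p \<in> vectors (I p)"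
  shows "sum_of_simple k I (card S) (\<lambda>m. \<Sum>s\<in>S. simple_tensor k I (v s) m)"
proof -
  obtain h where h: "bij_betw h {1..card S} S"
    using ex_bij_betw_nat_finite_1[OF assms(1)] by blast
  have "(\<Sum>s\<in>S. simple_tensor k I (v s) m)
      = (\<Sum>i\<in>{1..card S}. simple_tensor k I (v (h i)) m)" for m
    using sum.reindex_bij_betw[OF h, of "\<lambda>s. simple_tensor k I (v s) m"] by simp
  moreover have "\<forall>i\<in>{1..card S}. \<forall>p\<in>{1..k}. v (h i) p \<in> vectors (I p)"
    using assms(2) bij_betwE[OF h] by blast
  ultimately show ?thesis
    unfolding sum_of_simple_def by (intro exI[of _ "\<lambda>i. v (h i)"]) auto
qed

lemma simple_tensor_basis_vec:
  assumes "\<And>p. p \<in> {1..k} \<Longrightarrow> b p \<in> I p"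
  shows "simple_tensor k I (\<lambda>p. basis_vec (b p)) = indicator {restrict b {1..k}}"
proof
  fix m
  have "restrict b {1..k} \<in> multi_indices k I"
    using assms by (auto simp: multi_indices_def)
  moreover have "(\<Prod>p\<in>{1..k}. basis_vec (b p) (m p)) = indicator {restrict b {1..k}} m"
    if m: "m \<in> multi_indices k I"
  proof (cases "\<forall>p\<in>{1..k}. m p = b p")
    case True
    have "m \<in> extensional {1..k}"
      using m by (auto simp: multi_indices_def PiE_def)
    then have "m = restrict b {1..k}"
      using True by (intro extensionalityI[of m "{1..k}"]) auto
    then show ?thesis
      using True by (simp add: basis_vec_def)
  next
    case False
    then obtain p where "p \<in> {1..k}" "m p \<noteq> b p"
      by blast
    moreover from this have "m \<noteq> restrict b {1..k}"
      by auto
    ultimately show ?thesis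
      by (auto simp: basis_vec_def intro!: prod_zero)
  qed
  ultimately show "simple_tensor k I (\<lambda>p. basis_vec (b p)) m = indicator {restrict b {1..k}} m"
    by (auto simp: simple_tensor_def indicator_def)
qed

lemma multi_indices_mem: "m \<in> multi_indices k I \<Longrightarrow> p \<in> {1..k} \<Longrightarrow> m p \<in> I p"
  unfolding multi_indices_def by (rule PiE_mem)

lemma finite_multi_indices:
  assumes "\<And>p. p \<in> {1..k} \<Longrightarrow> finite (I p)"
  shows "finite (multi_indices k I)"
  using assms unfolding multi_indices_def by (intro finite_PiE) auto

text \<open>
  A tensor is the sum of its coordinates times product basis tensors; the scalar is absorbed into the
  first factor, which has to exist. Taking all multi-indices for \<open>S\<close>, this also shows that the minimum
  in the definition of tensor rank is attained.
\<close>

lemma sum_of_simple_card_support: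
  assumes k: "k \<ge> 1" and fin: "finite S" and S: "S \<subseteq> multi_indices k I"
    and T: "\<And>m. m \<notin> S \<Longrightarrow> T m = 0"
  shows "sum_of_simple k I (card S) T"
proof -
  define v where "v s p = (if p = 1 then (\<lambda>i. T s * basis_vec (s 1) i) else basis_vec (s p))"
    for s :: "nat \<Rightarrow> 'a" and p :: nat
  have simple: "simple_tensor k I (v s) m = T s * indicator {s} m" if s: "s \<in> S" for s m
  proof -
    have mem: "s p \<in> I p" if "p \<in> {1..k}" for p
      using multi_indices_mem[OF subsetD[OF S s] that] .
    have "s \<in> extensional {1..k}"
      using s S by (auto simp: multi_indices_def PiE_def)
    then have res: "restrict s {1..k} = s"
      by (simp add: extensional_restrict)
    have "(\<Prod>p\<in>{1..k}. v s p (m p)) = T s * (\<Prod>p\<in>{1..k}. basis_vec (s p) (m p))"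
    proof -
      have "(\<Prod>p\<in>{1..k}. v s p (m p))
          = (\<Prod>p\<in>{1..k}. (if p = 1 then T s else 1) * basis_vec (s p) (m p))"
        by (intro prod.cong) (auto simp: v_def)
      also have "\<dots> = T s * (\<Prod>p\<in>{1..k}. basis_vec (s p) (m p))"
        using k by (simp add: prod.distrib prod.delta)
      finally show ?thesis .
    qed
    then have "simple_tensor k I (v s) m = T s * simple_tensor k I (\<lambda>p. basis_vec (s p)) m"
      by (simp add: simple_tensor_def)
    then show ?thesis
      using simple_tensor_basis_vec[of k s I] mem res by simp
  qed
  have "T = (\<lambda>m. \<Sum>s\<in>S. simple_tensor k I (v s) m)"
  proof
    fix m
    have "(\<Sum>s\<in>S. simple_tensor k I (v s) m) = (\<Sum>s\<in>S. if s = m then T m else 0)"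
      by (intro sum.cong) (auto simp: simple indicator_def)
    then show "T m = (\<Sum>s\<in>S. simple_tensor k I (v s) m)"
      using T[of m] fin by (simp add: sum.delta)
  qed
  moreover have "v s p \<in> vectors (I p)" if "s \<in> S" "p \<in> {1..k}" for s p
  proof -
    have "s p \<in> I p"
      using multi_indices_mem[OF subsetD[OF S that(1)] that(2)] .
    then show ?thesis
      by (auto simp: v_def vectors_def basis_vec_def)
  qed
  ultimately show ?thesis
    using sum_of_simple_card[OF fin, of k v I] by simp
qed

lemma sum_of_simple_tensor_rank:
  assumes "k \<ge> 1" and "\<And>p. p \<in> {1..k} \<Longrightarrow> finite (I p)" and "T \<in> tensors k I"
  shows "sum_of_simple k I (tensor_rank k I T) T"
proof -
  have "sum_of_simple k I (card (multi_indices k I)) T"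
    using assms by (intro sum_of_simple_card_support finite_multi_indices) (auto simp: tensors_def)
  then show ?thesis
    unfolding tensor_rank_eq_Least by (rule LeastI)
qed

text \<open>
  Border rank asks for approximating tensors that all have the same rank. If their ranks are only
  bounded by \<open>r\<close>, then one value \<open>q \<le> r\<close> occurs for arbitrarily small parameters, and the family
  can be reparametrized so as to run through these parameters only.
\<close>

lemma border_rank_le:
  fixes F :: "complex \<Rightarrow> (nat \<Rightarrow> 'i) \<Rightarrow> complex"
  assumes F: "\<And>\<epsilon>. \<epsilon> \<noteq> 0 \<Longrightarrow> F \<epsilon> \<in> tensors k I \<and> tensor_rank k I (F \<epsilon>) \<le> r"
    and lim: "((\<lambda>\<epsilon>. tensor_dist k I (F \<epsilon>) T) \<longlongrightarrow> 0) (at 0)"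
  shows "border_rank k I T \<le> r"
proof -
  have "\<exists>q\<le>r. \<exists>\<^sub>F \<epsilon> in at (0 :: complex). tensor_rank k I (F \<epsilon>) = q"
  proof (rule ccontr)
    assume "\<not> ?thesis"
    then have "\<forall>q\<in>{..r}. \<forall>\<^sub>F \<epsilon> in at (0 :: complex). tensor_rank k I (F \<epsilon>) \<noteq> q"
      by (auto simp: frequently_def)
    then have "\<forall>\<^sub>F \<epsilon> in at (0 :: complex). \<forall>q\<in>{..r}. tensor_rank k I (F \<epsilon>) \<noteq> q"
      by (intro eventually_ball_finite) auto
    moreover have "\<forall>\<^sub>F \<epsilon> in at (0 :: complex). tensor_rank k I (F \<epsilon>) \<le> r"
      using F by (auto simp: eventually_at intro!: exI[of _ 1])
    ultimately have "\<forall>\<^sub>F \<epsilon> in at (0 :: complex). False"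
      by eventually_elim auto
    then show False
      by simp
  qed
  then obtain q where q: "q \<le> r" "\<exists>\<^sub>F \<epsilon> in at (0 :: complex). tensor_rank k I (F \<epsilon>) = q"
    by blast
  have "\<exists>\<eta>. \<eta> \<noteq> 0 \<and> norm \<eta> < norm \<epsilon> \<and> tensor_rank k I (F \<eta>) = q" if "\<epsilon> \<noteq> 0" for \<epsilon> :: complex
    using q(2) that unfolding frequently_at by (auto dest!: spec[of _ "norm \<epsilon>"])
  then have ex: "\<forall>\<epsilon> :: complex. \<exists>\<eta>. \<epsilon> \<noteq> 0 \<longrightarrow> \<eta> \<noteq> 0 \<and> norm \<eta> < norm \<epsilon> \<and> tensor_rank k I (F \<eta>) = q"
    by auto
  obtain g where
    "\<forall>\<epsilon> :: complex. \<epsilon> \<noteq> 0 \<longrightarrow> g \<epsilon> \<noteq> 0 \<and> norm (g \<epsilon>) < norm \<epsilon> \<and> tensor_rank k I (F (g \<epsilon>)) = q"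
    using choice[OF ex] by (rule exE)
  then have g: "g \<epsilon> \<noteq> 0" "norm (g \<epsilon>) < norm \<epsilon>" "tensor_rank k I (F (g \<epsilon>)) = q" if "\<epsilon> \<noteq> 0" for \<epsilon> :: complex
    using that by auto
  have "filterlim g (at 0) (at 0)"
    unfolding filterlim_at
  proof
    show "\<forall>\<^sub>F \<epsilon> in at 0. g \<epsilon> \<in> UNIV \<and> g \<epsilon> \<noteq> 0"
      unfolding eventually_at_filter using g(1) by (intro always_eventually) auto
    have "\<forall>\<^sub>F \<epsilon> in at 0. norm (g \<epsilon>) \<le> norm \<epsilon>"
      unfolding eventually_at_filter using g(2) by (intro always_eventually) (auto intro: less_imp_le)
    then show "(g \<longlongrightarrow> 0) (at 0)"
      by (rule Lim_null_comparison) (intro tendsto_norm_zero tendsto_ident_at)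
  qed
  then have "((\<lambda>\<epsilon>. tensor_dist k I (F (g \<epsilon>)) T) \<longlongrightarrow> 0) (at 0)"
    using lim filterlim_compose by blast
  then have "border_rank k I T \<le> q"
    unfolding border_rank_def using F g by (intro Least_le exI[of _ "\<lambda>\<epsilon>. F (g \<epsilon>)"]) auto
  then show ?thesis
    using q(1) by simp
qed

lemma tensor_dist_self: "tensor_dist k I T T = 0"
  by (simp add: tensor_dist_def L2_set_def)

lemma border_rank_indicator_le:
  assumes "k \<ge> 1" and "finite S" and "S \<subseteq> multi_indices k I"
  shows "border_rank k I (indicator S) \<le> card S"
proof (rule border_rank_le)
  show "indicator S \<in> tensors k I \<and> tensor_rank k I (indicator S) \<le> card S"
    using assms
    by (auto simp: tensors_def indicator_def intro!: tensor_rank_le sum_of_simple_card_support)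
qed (simp add: tensor_dist_self)

text \<open>
  Gaussian elimination of one unknown per equation.
\<close>

lemma homogeneous_system_nontrivial:
  fixes u :: "nat \<Rightarrow> 'a \<Rightarrow> 'b :: field"
  assumes "finite A" and "r < card A"
  shows "\<exists>c. (\<exists>a\<in>A. c a \<noteq> 0) \<and> (\<forall>i\<in>{1..r}. (\<Sum>a\<in>A. c a * u i a) = 0)"
  using assms
proof (induction r arbitrary: A u)
  case 0
  then obtain a where "a \<in> A"
    by fastforce
  then show ?case
    by (intro exI[of _ "\<lambda>_. 1"]) auto
next
  case (Suc r)
  show ?case
  proof (cases "\<forall>a\<in>A. u (Suc r) a = 0")
    case True
    obtain c where c: "\<exists>a\<in>A. c a \<noteq> 0" "\<forall>i\<in>{1..r}. (\<Sum>a\<in>A. c a * u i a) = 0"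
      using Suc.IH[of A u] Suc.prems by auto
    have "(\<Sum>a\<in>A. c a * u i a) = 0" if "i \<in> {1..Suc r}" for i
      using that c(2) True by (cases "i = Suc r") auto
    then show ?thesis
      using c(1) by blast
  next
    case False
    then obtain z where z: "z \<in> A" "u (Suc r) z \<noteq> 0"
      by blast
    define u' where "u' i a = u i a - u i z * u (Suc r) a / u (Suc r) z" for i a
    have "r < card (A - {z})"
      using Suc.prems z by simp
    then obtain c where c: "\<exists>a\<in>A - {z}. c a \<noteq> 0"
      "\<forall>i\<in>{1..r}. (\<Sum>a\<in>A - {z}. c a * u' i a) = 0"
      using Suc.IH[of "A - {z}" u'] Suc.prems by auto
    define c' where "c' = c(z := - (\<Sum>a\<in>A - {z}. c a * u (Suc r) a) / u (Suc r) z)"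
    have sum: "(\<Sum>a\<in>A. c' a * u i a) = (\<Sum>a\<in>A - {z}. c a * u' i a)" for i
    proof -
      have "(\<Sum>a\<in>A. c' a * u i a) = c' z * u i z + (\<Sum>a\<in>A - {z}. c' a * u i a)"
        using Suc.prems z by (simp add: sum.remove)
      also have "(\<Sum>a\<in>A - {z}. c' a * u i a) = (\<Sum>a\<in>A - {z}. c a * u i a)"
        by (intro sum.cong) (auto simp: c'_def)
      also have "c' z * u i z = - (\<Sum>a\<in>A - {z}. c a * (u i z * u (Suc r) a / u (Suc r) z))"
        by (simp add: c'_def sum_distrib_left sum_distrib_right sum_divide_distrib mult_ac)
      finally show ?thesis
        by (simp add: u'_def right_diff_distrib sum_subtractf)
    qed
    have "u' (Suc r) a = 0" for a
      using z by (simp add: u'_def)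
    then have "(\<Sum>a\<in>A. c' a * u i a) = 0" if "i \<in> {1..Suc r}" for i
      using that c(2) sum by (cases "i = Suc r") auto
    moreover have "\<exists>a\<in>A. c' a \<noteq> 0"
      using c(1) by (auto simp: c'_def)
    ultimately show ?thesis
      by blast
  qed
qed

lemma cmod_diff_le_tensor_dist:
  assumes "\<And>p. p \<in> {1..k} \<Longrightarrow> finite (I p)" and "m \<in> multi_indices k I"
  shows "cmod (T m - S m) \<le> tensor_dist k I T S"
  unfolding tensor_dist_def
  using member_le_L2_set[OF finite_multi_indices assms(2), of "\<lambda>m. cmod (T m - S m)"] assms(1)
  by simp

text \<open>
  The positions in \<open>P\<close> carry the row index \<open>a\<close> and the others the column index \<open>b\<close>, so \<open>T \<circ> \<mu>\<close> is the
  identity matrix and the flattening of a sum of \<open>r\<close> product tensors is a sum of \<open>r\<close> matrices of rank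
  one. If \<open>r < card A\<close>, such a sum has a nonzero vector \<open>c\<close> in its left kernel. Near the
  identity matrix this is impossible: look at an entry of \<open>c\<close> of maximal modulus.
\<close>

lemma border_rank_ge_identity_flattening:
  assumes k: "k \<ge> 1" and finI: "\<And>p. p \<in> {1..k} \<Longrightarrow> finite (I p)" and T: "T \<in> tensors k I"
    and fin: "finite A" and P: "P \<subseteq> {1..k}"
    and mem: "\<And>a b. a \<in> A \<Longrightarrow> b \<in> A \<Longrightarrow> \<mu> a b \<in> multi_indices k I"
    and split: "\<And>a b p. p \<in> {1..k} \<Longrightarrow> \<mu> a b p = (if p \<in> P then f p a else g p b)"
    and id: "\<And>a b. a \<in> A \<Longrightarrow> b \<in> A \<Longrightarrow> T (\<mu> a b) = of_bool (a = b)"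
  shows "card A \<le> border_rank k I T"
proof (rule ccontr)
  assume less: "\<not> ?thesis"
  define r where "r = border_rank k I T"
  have "\<exists>r. \<exists>F. (\<forall>\<epsilon>. \<epsilon> \<noteq> 0 \<longrightarrow> F \<epsilon> \<in> tensors k I \<and> tensor_rank k I (F \<epsilon>) = r) \<and>
    ((\<lambda>\<epsilon> :: complex. tensor_dist k I (F \<epsilon>) T) \<longlongrightarrow> 0) (at 0)"
    using T by (intro exI[of _ "tensor_rank k I T"] exI[of _ "\<lambda>_. T"])
      (auto simp: tensor_dist_self)
  then obtain F where F: "\<And>\<epsilon>. \<epsilon> \<noteq> 0 \<Longrightarrow> F \<epsilon> \<in> tensors k I \<and> tensor_rank k I (F \<epsilon>) = r"
    and lim: "((\<lambda>\<epsilon> :: complex. tensor_dist k I (F \<epsilon>) T) \<longlongrightarrow> 0) (at 0)"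
    unfolding r_def border_rank_def by (rule LeastI_ex[THEN exE]) blast
  have card: "r < card A"
    using less by (simp add: r_def)
  have "\<forall>\<^sub>F \<epsilon> in at 0. tensor_dist k I (F \<epsilon>) T < 1 / card A"
    using card by (intro order_tendstoD(2)[OF lim]) auto
  moreover have "\<forall>\<^sub>F \<epsilon> in at (0 :: complex). \<epsilon> \<noteq> 0"
    by (auto simp: eventually_at intro!: exI[of _ 1])
  ultimately have "\<forall>\<^sub>F \<epsilon> in at (0 :: complex). \<epsilon> \<noteq> 0 \<and> tensor_dist k I (F \<epsilon>) T < 1 / card A"
    by eventually_elim simp
  then obtain \<epsilon> :: complex where eps: "\<epsilon> \<noteq> 0" "tensor_dist k I (F \<epsilon>) T < 1 / card A"
    using eventually_happens by force
  have "sum_of_simple k I r (F \<epsilon>)"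
    using sum_of_simple_tensor_rank[OF k finI, where T = "F \<epsilon>"] F[OF eps(1)] by auto
  then obtain v where v: "F \<epsilon> = (\<lambda>m. \<Sum>i\<in>{1..r}. simple_tensor k I (v i) m)"
    unfolding sum_of_simple_def by blast
  define u where "u i a = (\<Prod>p\<in>P. v i p (f p a))" for i a
  define w where "w i b = (\<Prod>p\<in>{1..k} - P. v i p (g p b))" for i b
  have F\<mu>: "F \<epsilon> (\<mu> a b) = (\<Sum>i\<in>{1..r}. u i a * w i b)" if "a \<in> A" "b \<in> A" for a b
  proof -
    have "(\<Prod>p\<in>{1..k}. v i p (\<mu> a b p)) = u i a * w i b" for i
    proof -
      have "(\<Prod>p\<in>{1..k}. v i p (\<mu> a b p))
          = (\<Prod>p\<in>{1..k} - P. v i p (\<mu> a b p)) * (\<Prod>p\<in>P. v i p (\<mu> a b p))"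
        using P by (intro prod.subset_diff) auto
      also have "(\<Prod>p\<in>P. v i p (\<mu> a b p)) = u i a"
        unfolding u_def using P split by (intro prod.cong) auto
      also have "(\<Prod>p\<in>{1..k} - P. v i p (\<mu> a b p)) = w i b"
        unfolding w_def using split by (intro prod.cong) auto
      finally show ?thesis
        by (simp add: mult.commute)
    qed
    then show ?thesis
      unfolding v simple_tensor_def using mem[OF that] by simp
  qed
  obtain c where c: "\<exists>a\<in>A. c a \<noteq> 0" "\<forall>i\<in>{1..r}. (\<Sum>a\<in>A. c a * u i a) = 0"
    using homogeneous_system_nontrivial[OF fin card, of u] by blast
  have zero: "(\<Sum>a\<in>A. c a * F \<epsilon> (\<mu> a b)) = 0" if "b \<in> A" for b
  proof -
    have "(\<Sum>a\<in>A. c a * F \<epsilon> (\<mu> a b)) = (\<Sum>a\<in>A. \<Sum>i\<in>{1..r}. c a * u i a * w i b)"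
      using that by (intro sum.cong) (auto simp: F\<mu> sum_distrib_left mult_ac)
    also have "\<dots> = (\<Sum>i\<in>{1..r}. (\<Sum>a\<in>A. c a * u i a) * w i b)"
      unfolding sum_distrib_right by (rule sum.swap)
    finally show ?thesis
      using c(2) by simp
  qed
  define M where "M = Max ((\<lambda>a. cmod (c a)) ` A)"
  have M: "cmod (c a) \<le> M" if "a \<in> A" for a
    unfolding M_def using fin that by (intro Max_ge) auto
  have "M \<in> (\<lambda>a. cmod (c a)) ` A"
    unfolding M_def using fin c(1) by (intro Max_in) auto
  then obtain b where b: "b \<in> A" "cmod (c b) = M"
    by auto
  have Mpos: "M > 0"
    using c(1) M by (smt (verit) zero_less_norm_iff)
  have "(\<Sum>a\<in>A. c a * T (\<mu> a b)) = (\<Sum>a\<in>A. if a = b then c a else 0)"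
    using b id by (intro sum.cong) auto
  then have "c b = (\<Sum>a\<in>A. c a * T (\<mu> a b))"
    using b fin by (simp add: sum.delta)
  also have "\<dots> = - (\<Sum>a\<in>A. c a * (F \<epsilon> (\<mu> a b) - T (\<mu> a b)))"
    using zero[OF b(1)] by (simp add: right_diff_distrib sum_subtractf)
  finally have "M \<le> (\<Sum>a\<in>A. cmod (c a * (F \<epsilon> (\<mu> a b) - T (\<mu> a b))))"
    using b(2) norm_sum[of "\<lambda>a. c a * (F \<epsilon> (\<mu> a b) - T (\<mu> a b))" A] by simp
  also have "\<dots> \<le> (\<Sum>a\<in>A. M * tensor_dist k I (F \<epsilon>) T)"
  proof (intro sum_mono)
    fix a assume a: "a \<in> A"
    have "cmod (F \<epsilon> (\<mu> a b) - T (\<mu> a b)) \<le> tensor_dist k I (F \<epsilon>) T"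
      using cmod_diff_le_tensor_dist[OF finI mem[OF a b(1)]] .
    then show "cmod (c a * (F \<epsilon> (\<mu> a b) - T (\<mu> a b))) \<le> M * tensor_dist k I (F \<epsilon>) T"
      using M[OF a] Mpos by (simp add: norm_mult mult_mono)
  qed
  also have "\<dots> = M * (card A * tensor_dist k I (F \<epsilon>) T)"
    by simp
  also have "\<dots> < M * 1"
    using eps(2) Mpos card by (intro mult_strict_left_mono) (auto simp: field_simps)
  finally show False
    by simp
qed

section \<open>Degenerations of the cyclic group tensor\<close>

lemma sum_cis_multiples:
  assumes "R > 0"
  shows "(\<Sum>r\<in>{1..R}. cis (2 * pi * real r * of_int x / real R))
    = (if int R dvd x then of_nat R else 0)"
proof -
  define \<zeta> where "\<zeta> = cis (2 * pi * of_int x / real R)"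
  have pow: "cis (2 * pi * real r * of_int x / real R) = \<zeta> ^ r" for r
    by (simp add: \<zeta>_def Complex.DeMoivre mult_ac)
  have "\<zeta> ^ R = 1"
  proof -
    have "\<zeta> ^ R = cis (2 * pi * of_int x)"
      using assms by (simp add: \<zeta>_def Complex.DeMoivre)
    then show ?thesis
      by (simp add: cis_multiple_2pi)
  qed
  have one: "\<zeta> = 1 \<longleftrightarrow> int R dvd x"
  proof
    assume "\<zeta> = 1"
    then obtain j where "2 * pi * of_int x / real R = of_int j * (2 * pi)"
      unfolding \<zeta>_def cis_conv_exp exp_eq_1 by (auto simp: mult_ac)
    then have "of_int x = of_int j * real R"
      using assms by (simp add: field_simps)
    then have "x = j * int R"
      by (metis of_int_eq_iff of_int_mult of_int_of_nat_eq)
    then show "int R dvd x"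
      by simp
  next
    assume "int R dvd x"
    then obtain j where "x = int R * j"
      by blast
    then have "2 * pi * of_int x / real R = 2 * pi * of_int j"
      using assms by simp
    then show "\<zeta> = 1"
      unfolding \<zeta>_def by (simp add: cis_multiple_2pi)
  qed
  have "(\<Sum>r\<in>{1..R}. \<zeta> ^ r) = \<zeta> * (\<Sum>r<R. \<zeta> ^ r)"
    by (simp add: sum_distrib_left sum.atLeast1_atMost_eq)
  moreover have "(\<Sum>r<R. \<zeta> ^ r) = 0" if "\<zeta> \<noteq> 1"
    using geometric_sum[OF that, of R] \<open>\<zeta> ^ R = 1\<close> by simp
  ultimately show ?thesis
    using one by (cases "\<zeta> = 1") (auto simp: pow)
qed

text \<open>
  The summand of index \<open>r\<close> below is the product tensor whose entry at \<open>i\<close> in factor \<open>p\<close> is \<open>\<epsilon> powi W p i\<close>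
  times the \<open>r\<close>-th power of the primitive \<open>R\<close>-th root of unity raised to \<open>X p i\<close>. Orthogonality of
  characters cancels the coordinates whose total exponent is not divisible by \<open>R\<close>.
\<close>

lemma border_rank_cyclic_degeneration:
  fixes X W :: "nat \<Rightarrow> 'i \<Rightarrow> int"
  assumes k: "k \<ge> 1" and R: "R > 0"
    and on: "\<And>m. m \<in> S \<Longrightarrow>
      int R dvd (\<Sum>p\<in>{1..k}. X p (m p)) \<and> (\<Sum>p\<in>{1..k}. W p (m p)) = 0"
    and off: "\<And>m. m \<in> multi_indices k I \<Longrightarrow> m \<notin> S \<Longrightarrow>
      int R dvd (\<Sum>p\<in>{1..k}. X p (m p)) \<Longrightarrow> (\<Sum>p\<in>{1..k}. W p (m p)) > 0"
  shows "border_rank k I (indicator S) \<le> R"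
proof -
  let ?X = "\<lambda>m. \<Sum>p\<in>{1..k}. X p (m p)" and ?W = "\<lambda>m. \<Sum>p\<in>{1..k}. W p (m p)"
  define F where "F \<epsilon> m =
    (if m \<in> multi_indices k I \<and> int R dvd ?X m then \<epsilon> powi ?W m else 0)" for \<epsilon> :: complex and m
  define v where "v \<epsilon> r p i = (if i \<in> I p then (if p = 1 then 1 / of_nat R else 1)
      * (cis (2 * pi * real r * of_int (X p i) / real R) * \<epsilon> powi W p i) else 0)"
    for \<epsilon> :: complex and r :: nat and p i
  have simple: "simple_tensor k I (v \<epsilon> r) m = (if m \<in> multi_indices k I
      then cis (2 * pi * real r * of_int (?X m) / real R) / of_nat R * \<epsilon> powi ?W m else 0)"
    if eps: "\<epsilon> \<noteq> 0" for \<epsilon> r m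
  proof (cases "m \<in> multi_indices k I")
    case True
    then have "(\<Prod>p\<in>{1..k}. v \<epsilon> r p (m p)) = (\<Prod>p\<in>{1..k}. (if p = 1 then 1 / of_nat R else 1)
      * (cis (2 * pi * real r * of_int (X p (m p)) / real R) * \<epsilon> powi W p (m p)))"
      by (intro prod.cong) (auto simp: v_def dest: multi_indices_mem)
    also have "\<dots> = 1 / of_nat R * ((\<Prod>p\<in>{1..k}. cis (2 * pi * real r * of_int (X p (m p)) / real R))
        * (\<Prod>p\<in>{1..k}. \<epsilon> powi W p (m p)))"
      using k by (simp add: prod.distrib prod.delta)
    also have "(\<Prod>p\<in>{1..k}. cis (2 * pi * real r * of_int (X p (m p)) / real R))
        = cis (\<Sum>p\<in>{1..k}. 2 * pi * real r * of_int (X p (m p)) / real R)"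
      by (induction k) (simp_all add: cis_mult)
    also have "(\<Sum>p\<in>{1..k}. 2 * pi * real r * of_int (X p (m p)) / real R)
        = 2 * pi * real r * of_int (?X m) / real R"
      by (simp add: sum_divide_distrib sum_distrib_left)
    also have "(\<Prod>p\<in>{1..k}. \<epsilon> powi W p (m p)) = \<epsilon> powi ?W m"
      using eps by (induction k) (simp_all add: power_int_add)
    finally show ?thesis
      using True by (simp add: simple_tensor_def)
  qed (simp add: simple_tensor_def)
  have "sum_of_simple k I R (F \<epsilon>)" if eps: "\<epsilon> \<noteq> 0" for \<epsilon>
    unfolding sum_of_simple_def
  proof (intro exI[of _ "v \<epsilon>"] conjI ext)
    show "\<forall>i\<in>{1..R}. \<forall>p\<in>{1..k}. v \<epsilon> i p \<in> vectors (I p)"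
      by (auto simp: vectors_def v_def)
    fix m
    show "F \<epsilon> m = (\<Sum>i = 1..R. simple_tensor k I (v \<epsilon> i) m)"
    proof (cases "m \<in> multi_indices k I")
      case True
      then have "(\<Sum>i = 1..R. simple_tensor k I (v \<epsilon> i) m)
        = (\<Sum>i = 1..R. cis (2 * pi * real i * of_int (?X m) / real R)) / of_nat R * \<epsilon> powi ?W m"
        unfolding simple[OF eps] sum_divide_distrib sum_distrib_right by simp
      then show ?thesis
        unfolding sum_cis_multiples[OF R] using True R by (simp add: F_def)
    qed (simp add: simple[OF eps] F_def)
  qed
  then have rank: "F \<epsilon> \<in> tensors k I \<and> tensor_rank k I (F \<epsilon>) \<le> R" if "\<epsilon> \<noteq> 0" for \<epsilon>
    using that by (auto simp: tensors_def F_def intro!: tensor_rank_le)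
  have coord: "((\<lambda>\<epsilon>. F \<epsilon> m - indicator S m) \<longlongrightarrow> 0) (at 0)" if m: "m \<in> multi_indices k I" for m
  proof (cases "m \<in> S \<or> \<not> int R dvd ?X m")
    case True
    then have "(\<lambda>\<epsilon>. F \<epsilon> m - indicator S m) = (\<lambda>_. 0)"
      using on[of m] m by (cases "m \<in> S") (auto simp: F_def)
    then show ?thesis
      by simp
  next
    case False
    then have W: "?W m > 0" and "m \<notin> S"
      using off[OF m] by auto
    then have "(\<lambda>\<epsilon>. F \<epsilon> m - indicator S m) = (\<lambda>\<epsilon>. \<epsilon> ^ nat (?W m))"
      using False m by (auto simp: F_def power_int_def)
    moreover have "((\<lambda>\<epsilon>. \<epsilon> ^ nat (?W m)) \<longlongrightarrow> (0 :: complex) ^ nat (?W m)) (at 0)"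
      by (intro tendsto_intros)
    ultimately show ?thesis
      using W by (simp add: zero_power)
  qed
  have "((\<lambda>\<epsilon>. \<Sum>m\<in>multi_indices k I. cmod (F \<epsilon> m - indicator S m)) \<longlongrightarrow> 0) (at 0)"
    using coord by (intro tendsto_null_sum tendsto_norm_zero)
  then have "((\<lambda>\<epsilon>. tensor_dist k I (F \<epsilon>) (indicator S)) \<longlongrightarrow> 0) (at 0)"
  proof (rule Lim_null_comparison[rotated])
    show "\<forall>\<^sub>F \<epsilon> in at 0. norm (tensor_dist k I (F \<epsilon>) (indicator S))
      \<le> (\<Sum>m\<in>multi_indices k I. cmod (F \<epsilon> m - indicator S m))"
      unfolding tensor_dist_def
      by (intro always_eventually allI) (simp add: L2_set_nonneg L2_set_le_sum)
  qed
  then show ?thesis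
    using rank by (intro border_rank_le) auto
qed

section \<open>The two summands\<close>

definition T1_entry :: "nat \<Rightarrow> nat list \<Rightarrow> nat \<Rightarrow> nat list"
  where "T1_entry d is = (\<lambda>p\<in>{1..d + 1}. if p \<le> d then [is ! (p - 1)] else is)"

definition T2_entry :: "nat \<Rightarrow> nat \<Rightarrow> nat \<Rightarrow> nat"
  where "T2_entry d j = (\<lambda>p\<in>{1..d + 1}. if p \<le> 2 then j else 1)"

lemma finite_tuples: "finite (tuples d n)" and card_tuples: "card (tuples d n) = n ^ d"
  using finite_lists_length_eq[of "{1..n}" d] card_lists_length_eq[of "{1..n}" d]
  by (auto simp: tuples_def conj_commute)

lemma tuples_nth: "is \<in> tuples d n \<Longrightarrow> p \<in> {1..d} \<Longrightarrow> is ! (p - 1) \<in> {1..n}"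
  using nth_mem[of "p - 1" "is"] by (fastforce simp: tuples_def)

lemma finite_V_indices: "finite (V_indices d n p)"
  by (simp add: V_indices_def finite_tuples)

lemma finite_W_indices: "finite (W_indices N p)"
  by (simp add: W_indices_def)

lemma T1_entry_mem: "is \<in> tuples d n \<Longrightarrow> T1_entry d is \<in> multi_indices (d + 1) (V_indices d n)"
  unfolding multi_indices_def
proof (rule PiE_I)
  fix p assume "is \<in> tuples d n" "p \<in> {1..d + 1}"
  then show "T1_entry d is p \<in> V_indices d n p"
    using tuples_nth[of "is" d n p] by (auto simp: T1_entry_def V_indices_def)
qed (auto simp: T1_entry_def)

lemma T2_entry_mem: "j \<in> {1..N} \<Longrightarrow> T2_entry d j \<in> multi_indices (d + 1) (W_indices N)"
  unfolding multi_indices_def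
  by (rule PiE_I) (auto simp: T2_entry_def W_indices_def)

lemma inj_T1_entry: "inj (T1_entry d)"
  by (rule injI, drule fun_cong[of _ _ "d + 1"]) (simp add: T1_entry_def)

lemma inj_T2_entry: "inj (T2_entry d)"
  by (rule injI, drule fun_cong[of _ _ 1]) (simp add: T2_entry_def)

lemma sum_indicator_inj_on:
  assumes "finite A" and "inj_on f A"
  shows "(\<Sum>a\<in>A. indicator {f a} m) = (indicator (f ` A) m :: complex)"
proof (cases "m \<in> f ` A")
  case True
  then obtain b where b: "b \<in> A" "m = f b"
    by blast
  have "(\<Sum>a\<in>A. indicator {f a} m :: complex) = (\<Sum>a\<in>A. if a = b then 1 else 0)"
    using b assms(2) by (intro sum.cong) (auto simp: indicator_def inj_on_def)
  then show ?thesis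
    using True b assms(1) by (simp add: sum.delta)
next
  case False
  then have "indicator {f a} m = (0 :: complex)" if "a \<in> A" for a
    using that by (auto simp: indicator_def)
  then show ?thesis
    using False by simp
qed

lemma T1_eq_indicator: "T1 d n = indicator (T1_entry d ` tuples d n)"
proof
  fix m
  have "simple_tensor (d + 1) (V_indices d n)
      (\<lambda>p. if p \<le> d then basis_vec [is ! (p - 1)] else basis_vec is) = indicator {T1_entry d is}"
    if "is \<in> tuples d n" for "is"
  proof -
    have "(if p \<le> d then [is ! (p - 1)] else is) \<in> V_indices d n p" if "p \<in> {1..d + 1}" for p
      using multi_indices_mem[OF T1_entry_mem[OF \<open>is \<in> tuples d n\<close>] that] that
      by (simp add: T1_entry_def)
    then show ?thesis
      using simple_tensor_basis_vec[of "d + 1" "\<lambda>p. if p \<le> d then [is ! (p - 1)] else is"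
          "V_indices d n"]
      by (simp add: T1_entry_def if_distrib[of basis_vec])
  qed
  then show "T1 d n m = indicator (T1_entry d ` tuples d n) m"
    unfolding T1_def
    using sum_indicator_inj_on[OF finite_tuples inj_on_subset[OF inj_T1_entry subset_UNIV]]
    by simp
qed

lemma T2_eq_indicator: "T2 d N = indicator (T2_entry d ` {1..N})"
proof
  fix m
  have "simple_tensor (d + 1) (W_indices N)
      (\<lambda>p. if p \<le> 2 then basis_vec j else basis_vec 1) = indicator {T2_entry d j}"
    if "j \<in> {1..N}" for j
  proof -
    have "(if p \<le> 2 then j else 1) \<in> W_indices N p" if "p \<in> {1..d + 1}" for p
      using multi_indices_mem[OF T2_entry_mem[OF \<open>j \<in> {1..N}\<close>] that] that
      by (simp add: T2_entry_def)
    then show ?thesis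
      using simple_tensor_basis_vec[of "d + 1" "\<lambda>p. if p \<le> 2 then j else 1" "W_indices N"]
      by (simp add: T2_entry_def if_distrib[of basis_vec])
  qed
  then show "T2 d N m = indicator (T2_entry d ` {1..N}) m"
    unfolding T2_def
    using sum_indicator_inj_on[OF _ inj_on_subset[OF inj_T2_entry subset_UNIV], of "{1..N}"]
    by simp
qed

text \<open>
  The last factor records the whole multi-index, so separating it from the first \<open>d\<close> factors gives an
  identity matrix of size \<open>n ^ d\<close>.
\<close>

lemma border_rank_T1: "border_rank (d + 1) (V_indices d n) (T1 d n) = n ^ d"
proof (rule antisym)
  have sub: "T1_entry d ` tuples d n \<subseteq> multi_indices (d + 1) (V_indices d n)"
    using T1_entry_mem by blast
  have "border_rank (d + 1) (V_indices d n) (T1 d n) \<le> card (T1_entry d ` tuples d n)"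
    unfolding T1_eq_indicator by (intro border_rank_indicator_le sub) (simp_all add: finite_tuples)
  also have "\<dots> \<le> n ^ d"
    using card_image_le[OF finite_tuples] by (metis card_tuples)
  finally show "border_rank (d + 1) (V_indices d n) (T1 d n) \<le> n ^ d" .
  define \<mu> where "\<mu> a b = (\<lambda>p\<in>{1..d + 1}. if p \<in> {1..d} then [a ! (p - 1)] else b)"
    for a b :: "nat list"
  have "card (tuples d n) \<le> border_rank (d + 1) (V_indices d n) (T1 d n)"
  proof (rule border_rank_ge_identity_flattening[where \<mu> = \<mu> and P = "{1..d}"
        and f = "\<lambda>p a. [a ! (p - 1)]" and g = "\<lambda>p b. b"])
    show "T1 d n \<in> tensors (d + 1) (V_indices d n)"
      using sub by (auto simp: T1_eq_indicator tensors_def indicator_def)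
    fix a b assume a: "a \<in> tuples d n" and b: "b \<in> tuples d n"
    show "\<mu> a b \<in> multi_indices (d + 1) (V_indices d n)"
      unfolding multi_indices_def
    proof (rule PiE_I)
      fix p assume "p \<in> {1..d + 1}"
      then show "\<mu> a b p \<in> V_indices d n p"
        using tuples_nth[OF a, of p] b by (auto simp: \<mu>_def V_indices_def)
    qed (auto simp: \<mu>_def)
    have "\<mu> a b = T1_entry d c \<longleftrightarrow> a = b \<and> c = b" if c: "c \<in> tuples d n" for c
    proof
      assume eq: "\<mu> a b = T1_entry d c"
      have "c = b"
        using fun_cong[OF eq, of "d + 1"] by (simp add: \<mu>_def T1_entry_def)
      moreover have "a = c"
      proof (rule nth_equalityI)
        show "length a = length c"
          using a c by (simp add: tuples_def)
        fix i assume "i < length a"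
        then have "Suc i \<in> {1..d}"
          using a by (simp add: tuples_def)
        then show "a ! i = c ! i"
          using fun_cong[OF eq, of "Suc i"] by (simp add: \<mu>_def T1_entry_def)
      qed
      ultimately show "a = b \<and> c = b"
        by simp
    next
      assume "a = b \<and> c = b"
      then show "\<mu> a b = T1_entry d c"
        by (auto simp: \<mu>_def T1_entry_def fun_eq_iff)
    qed
    then have "\<mu> a b \<in> T1_entry d ` tuples d n \<longleftrightarrow> a = b"
      using b by auto
    then show "T1 d n (\<mu> a b) = of_bool (a = b)"
      by (simp add: T1_eq_indicator indicator_def)
  next
    fix a b p assume "p \<in> {1..d + 1}"
    then show "\<mu> a b p = (if p \<in> {1..d} then [a ! (p - 1)] else b)"
      by (simp add: \<mu>_def)
  qed (auto simp: finite_V_indices finite_tuples)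
  then show "n ^ d \<le> border_rank (d + 1) (V_indices d n) (T1 d n)"
    by (simp only: card_tuples)
qed

text \<open>
  Here the first factor records the summand, and so do the remaining factors through the second one.
\<close>

lemma border_rank_T2:
  assumes "d \<ge> 1"
  shows "border_rank (d + 1) (W_indices N) (T2 d N) = N"
proof (rule antisym)
  have sub: "T2_entry d ` {1..N} \<subseteq> multi_indices (d + 1) (W_indices N)"
    using T2_entry_mem by blast
  have "border_rank (d + 1) (W_indices N) (T2 d N) \<le> card (T2_entry d ` {1..N})"
    unfolding T2_eq_indicator by (intro border_rank_indicator_le sub) simp_all
  also have "\<dots> \<le> N"
    using card_image_le[of "{1..N}" "T2_entry d"] by simp
  finally show "border_rank (d + 1) (W_indices N) (T2 d N) \<le> N" .
  define \<mu> where "\<mu> a b = (\<lambda>p\<in>{1..d + 1}. if p \<in> {1} then a else if p = 2 then b else 1)"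
    for a b :: nat
  have "card {1..N} \<le> border_rank (d + 1) (W_indices N) (T2 d N)"
  proof (rule border_rank_ge_identity_flattening[where \<mu> = \<mu> and P = "{1}"
        and f = "\<lambda>p a. a" and g = "\<lambda>p b. if p = 2 then b else 1"])
    show "T2 d N \<in> tensors (d + 1) (W_indices N)"
      using sub by (auto simp: T2_eq_indicator tensors_def indicator_def)
    fix a b assume a: "a \<in> {1..N}" and b: "b \<in> {1..N}"
    show "\<mu> a b \<in> multi_indices (d + 1) (W_indices N)"
      unfolding multi_indices_def
    proof (rule PiE_I)
      fix p assume "p \<in> {1..d + 1}"
      then show "\<mu> a b p \<in> W_indices N p"
        using a b by (auto simp: \<mu>_def W_indices_def)
    qed (auto simp: \<mu>_def)
    have "\<mu> a b = T2_entry d c \<longleftrightarrow> a = b \<and> c = b" for c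
    proof
      assume eq: "\<mu> a b = T2_entry d c"
      show "a = b \<and> c = b"
        using fun_cong[OF eq, of 1] fun_cong[OF eq, of 2] assms
        by (simp add: \<mu>_def T2_entry_def)
    next
      assume "a = b \<and> c = b"
      then show "\<mu> a b = T2_entry d c"
        by (auto simp: \<mu>_def T2_entry_def fun_eq_iff)
    qed
    then have "\<mu> a b \<in> T2_entry d ` {1..N} \<longleftrightarrow> a = b"
      using b by auto
    then show "T2 d N (\<mu> a b) = of_bool (a = b)"
      by (simp add: T2_eq_indicator indicator_def)
  next
    fix a b p assume "p \<in> {1..d + 1}"
    then show "\<mu> a b p = (if p \<in> {1} then a else if p = 2 then b else 1)"
      by (simp add: \<mu>_def)
  qed (auto simp: finite_W_indices)
  then show "N \<le> border_rank (d + 1) (W_indices N) (T2 d N)"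
    by simp
qed

section \<open>The direct sum\<close>

lemma indicator_relabelled:
  assumes S: "S \<subseteq> multi_indices k I" and u: "\<And>x. u (c x) = x"
  shows "(if m \<in> multi_indices k (\<lambda>p. c ` I p) then indicator S (\<lambda>p\<in>{1..k}. u (m p)) else 0)
    = (indicator ((\<lambda>s. \<lambda>p\<in>{1..k}. c (s p)) ` S) m :: complex)"
proof -
  have "m \<in> (\<lambda>s. \<lambda>p\<in>{1..k}. c (s p)) ` S \<longleftrightarrow>
    m \<in> multi_indices k (\<lambda>p. c ` I p) \<and> (\<lambda>p\<in>{1..k}. u (m p)) \<in> S" (is "?L \<longleftrightarrow> ?R")
  proof
    assume ?L
    then obtain s where s: "s \<in> S" "m = (\<lambda>p\<in>{1..k}. c (s p))"
      by blast
    have "s \<in> extensional {1..k}"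
      using s(1) S by (auto simp: multi_indices_def PiE_def)
    then have "(\<lambda>p\<in>{1..k}. u (m p)) = s"
      using s(2) u by (intro extensionalityI[of _ "{1..k}"]) auto
    moreover have "m \<in> multi_indices k (\<lambda>p. c ` I p)"
      unfolding multi_indices_def s(2)
      using multi_indices_mem[OF subsetD[OF S s(1)]] by (intro PiE_I) auto
    ultimately show ?R
      using s(1) by simp
  next
    assume R: ?R
    have "m = (\<lambda>p\<in>{1..k}. c ((\<lambda>p\<in>{1..k}. u (m p)) p))"
    proof (rule extensionalityI[of _ "{1..k}"])
      show "m \<in> extensional {1..k}"
        using R by (auto simp: multi_indices_def PiE_def)
      fix p assume p: "p \<in> {1..k}"
      then have "m p \<in> c ` I p"
        using R multi_indices_mem[of m k "\<lambda>p. c ` I p" p] by simp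
      then show "m p = (\<lambda>p\<in>{1..k}. c ((\<lambda>p\<in>{1..k}. u (m p)) p)) p"
        using p u by auto
    qed simp
    then show ?L
      using R by (rule image_eqI[OF _ conjunct2])
  qed
  then show ?thesis
    by (simp add: indicator_def)
qed

lemma embed_left_indicator:
  assumes "S \<subseteq> multi_indices k I"
  shows "embed_left k I (indicator S) = indicator ((\<lambda>s. \<lambda>p\<in>{1..k}. Inl (s p)) ` S)"
  unfolding embed_left_def using assms
  by (intro ext indicator_relabelled[where u = projl and c = Inl]) simp_all

lemma embed_right_indicator:
  assumes "S \<subseteq> multi_indices k J"
  shows "embed_right k J (indicator S) = indicator ((\<lambda>s. \<lambda>p\<in>{1..k}. Inr (s p)) ` S)"
  unfolding embed_right_def using assms
  by (intro ext indicator_relabelled[where u = projr and c = Inr]) simp_all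

definition sum_support :: "nat \<Rightarrow> nat \<Rightarrow> nat \<Rightarrow> (nat \<Rightarrow> nat list + nat) set"
  where "sum_support d n N =
    (\<lambda>is. \<lambda>p\<in>{1..d + 1}. Inl (T1_entry d is p)) ` tuples d n
    \<union> (\<lambda>j. \<lambda>p\<in>{1..d + 1}. Inr (T2_entry d j p)) ` {1..N}"

lemma direct_sum_eq_indicator:
  "direct_sum (d + 1) (V_indices d n) (W_indices N) (T1 d n) (T2 d N)
    = indicator (sum_support d n N)"
proof
  fix m :: "nat \<Rightarrow> nat list + nat"
  let ?L = "(\<lambda>is. \<lambda>p\<in>{1..d + 1}. Inl (T1_entry d is p)) ` tuples d n :: (nat \<Rightarrow> nat list + nat) set"
    and ?R = "(\<lambda>j. \<lambda>p\<in>{1..d + 1}. Inr (T2_entry d j p)) ` {1..N} :: (nat \<Rightarrow> nat list + nat) set"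
  have "?L \<inter> ?R = {}"
    by (auto dest: fun_cong[of _ _ 1])
  moreover have "embed_left (d + 1) (V_indices d n) (T1 d n) = indicator ?L"
    unfolding T1_eq_indicator
    by (subst embed_left_indicator) (auto simp: T1_entry_mem image_image simp del: One_nat_def)
  moreover have "embed_right (d + 1) (W_indices N) (T2 d N) = indicator ?R"
    unfolding T2_eq_indicator
    by (subst embed_right_indicator) (auto simp: T2_entry_mem image_image simp del: One_nat_def)
  ultimately show "direct_sum (d + 1) (V_indices d n) (W_indices N) (T1 d n) (T2 d N) m
      = indicator (sum_support d n N) m"
    unfolding direct_sum_def sum_support_def by (auto simp: indicator_def)
qed

lemma sum_support_subset:
  "sum_support d n N \<subseteq> multi_indices (d + 1) (sum_indices (V_indices d n) (W_indices N))"
proof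
  fix m assume "m \<in> sum_support d n N"
  then consider (left) "is" where "is \<in> tuples d n" "m = (\<lambda>p\<in>{1..d + 1}. Inl (T1_entry d is p))"
    | (right) j where "j \<in> {1..N}" "m = (\<lambda>p\<in>{1..d + 1}. Inr (T2_entry d j p))"
    unfolding sum_support_def by blast
  then show "m \<in> multi_indices (d + 1) (sum_indices (V_indices d n) (W_indices N))"
  proof cases
    case left
    show ?thesis
      unfolding left(2) multi_indices_def sum_indices_def
      using multi_indices_mem[OF T1_entry_mem[OF left(1)]] by (intro PiE_I) auto
  next
    case right
    show ?thesis
      unfolding right(2) multi_indices_def sum_indices_def
      using multi_indices_mem[OF T2_entry_mem[OF right(1)]] by (intro PiE_I) auto
  qed
qed

lemma border_rank_direct_sum_le_add:
  "border_rank (d + 1) (sum_indices (V_indices d n) (W_indices N))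
    (direct_sum (d + 1) (V_indices d n) (W_indices N) (T1 d n) (T2 d N)) \<le> n ^ d + N"
proof -
  have "border_rank (d + 1) (sum_indices (V_indices d n) (W_indices N))
      (indicator (sum_support d n N)) \<le> card (sum_support d n N)"
    by (intro border_rank_indicator_le sum_support_subset)
      (simp_all add: sum_support_def finite_tuples)
  also have "\<dots> \<le> n ^ d + N"
    unfolding sum_support_def
    by (intro order_trans[OF card_Un_le] add_mono order_trans[OF card_image_le])
      (simp_all add: finite_tuples card_tuples)
  finally show ?thesis
    by (simp only: direct_sum_eq_indicator)
qed

section \<open>A cyclic degeneration of the direct sum\<close>

text \<open>
  The digits run from \<open>1\<close> to \<open>n\<close> and not from \<open>0\<close> to \<open>n - 1\<close>, so that every digit contributes at least
  \<open>1\<close> to the exponent of a multi-index. The last digit is determined modulo \<open>n\<close>.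
\<close>

lemma bijective_base_unique:
  fixes a b :: "nat \<Rightarrow> nat"
  assumes "\<And>p. p \<in> {1..d} \<Longrightarrow> a p \<in> {1..n}" and "\<And>p. p \<in> {1..d} \<Longrightarrow> b p \<in> {1..n}"
    and "(\<Sum>p\<in>{1..d}. a p * n ^ (d - p)) = (\<Sum>p\<in>{1..d}. b p * n ^ (d - p))"
    and "p \<in> {1..d}"
  shows "a p = b p"
  using assms
proof (induction d arbitrary: p)
  case (Suc d)
  have shift: "(\<Sum>p\<in>{1..Suc d}. c p * n ^ (Suc d - p)) = n * (\<Sum>p\<in>{1..d}. c p * n ^ (d - p)) + c (Suc d)"
    for c :: "nat \<Rightarrow> nat"
    by (simp add: sum_distrib_left Suc_diff_le mult_ac)
  let ?A = "\<Sum>p\<in>{1..d}. a p * n ^ (d - p)" and ?B = "\<Sum>p\<in>{1..d}. b p * n ^ (d - p)"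
  have eq: "n * ?A + a (Suc d) = n * ?B + b (Suc d)"
    using Suc.prems(3) unfolding shift .
  have last: "a (Suc d) \<in> {1..n}" "b (Suc d) \<in> {1..n}"
    using Suc.prems(1,2)[of "Suc d"] by auto
  have AB: "?A = ?B"
  proof (rule ccontr)
    assume "?A \<noteq> ?B"
    then have "?A + 1 \<le> ?B \<or> ?B + 1 \<le> ?A"
      by auto
    then have "n * (?A + 1) \<le> n * ?B \<or> n * (?B + 1) \<le> n * ?A"
      by (meson mult_le_mono2)
    then show False
      using eq last by auto
  qed
  show ?case
  proof (cases "p = Suc d")
    case True
    then show ?thesis
      using eq AB by simp
  next
    case False
    then show ?thesis
      using Suc.IH[of p] Suc.prems AB by simp
  qed
qed simp

text \<open>
  The intervals have at most \<open>n * (\<sigma> + 1)\<close> elements altogether.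
\<close>

lemma exponents_avoiding_intervals:
  fixes c :: "nat \<Rightarrow> nat" and L N n \<sigma> :: nat
  assumes "N \<le> L"
  shows "\<exists>e. inj_on e {1..N} \<and>
    (\<forall>j\<in>{1..N}. 1 \<le> e j \<and> e j \<le> L + n * (\<sigma> + 1) \<and> (\<forall>i\<in>{1..n}. e j \<notin> {c i..c i + \<sigma>}))"
proof -
  define bad where "bad = (\<Union>i\<in>{1..n}. {c i..c i + \<sigma>})"
  have "card bad \<le> (\<Sum>i\<in>{1..n}. card {c i..c i + \<sigma>})"
    unfolding bad_def by (rule card_UN_le) simp
  then have "card bad \<le> n * (\<sigma> + 1)"
    by simp
  moreover have "card {1..L + n * (\<sigma> + 1)} - card bad \<le> card ({1..L + n * (\<sigma> + 1)} - bad)"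
    by (rule diff_card_le_card_Diff) (simp add: bad_def)
  ultimately have "card {1..N} \<le> card ({1..L + n * (\<sigma> + 1)} - bad)"
    using assms by simp
  then obtain e where "e ` {1..N} \<subseteq> {1..L + n * (\<sigma> + 1)} - bad" "inj_on e {1..N}"
    using card_le_inj[of "{1..N}" "{1..L + n * (\<sigma> + 1)} - bad"] by auto
  moreover from this have "e j \<in> {1..L + n * (\<sigma> + 1)} - bad" if "j \<in> {1..N}" for j
    using that by blast
  ultimately show ?thesis
    unfolding bad_def by (intro exI[of _ e]) fastforce
qed

text \<open>
  The exponents add up to \<open>0\<close> on the multi-indices of both summands: on those of \<open>T\<^sub>1\<close> because the last
  factor carries the negative of the number whose digits are in the first \<open>d\<close> factors, on those of
  \<open>T\<^sub>2\<close> because the first two factors cancel.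
\<close>

definition cyclic_exponent :: "nat \<Rightarrow> nat \<Rightarrow> (nat \<Rightarrow> nat) \<Rightarrow> nat \<Rightarrow> nat list + nat \<Rightarrow> int"
  where "cyclic_exponent d n e p x = (case x of
      Inl l \<Rightarrow> if p \<le> d then int (hd l * n ^ (d - p)) else - int (\<Sum>q\<in>{1..d}. l ! (q - 1) * n ^ (d - q))
    | Inr j \<Rightarrow> if p = 1 then int (e j) else if p = 2 then - int (e j) else 0)"

text \<open>
  The weights of the first two factors are positive when the values of \<open>e\<close> are less than \<open>R\<close>; at indices
  \<open>j\<close> and \<open>j'\<close> they add up to \<open>4 R + 2 (e j' - e j)\<close>. The last weight makes the total \<open>0\<close> on the
  multi-indices of \<open>T\<^sub>2\<close>, where the \<open>d - 2\<close> middle factors contribute \<open>1\<close> each.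
\<close>

definition degeneration_weight :: "nat \<Rightarrow> nat \<Rightarrow> (nat \<Rightarrow> nat) \<Rightarrow> nat \<Rightarrow> nat list + nat \<Rightarrow> int"
  where "degeneration_weight d R e p x = (case x of
      Inl l \<Rightarrow> 0
    | Inr j \<Rightarrow> if p = 1 then 2 * int R - 2 * int (e j) else if p = 2 then 2 * int R + 2 * int (e j)
        else if p = d + 1 then - (4 * int R + int (d - 2)) else 1)"

lemma sum_split_first_two_last:
  fixes f :: "nat \<Rightarrow> 'a :: comm_monoid_add"
  assumes "d \<ge> 2"
  shows "(\<Sum>p\<in>{1..d + 1}. f p) = f 1 + f 2 + (\<Sum>p\<in>{3..d}. f p) + f (d + 1)"
proof -
  have "{1..d + 1} = insert 1 (insert 2 (insert (d + 1) {3..d}))"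
    using assms by auto
  then show ?thesis
    using assms by (simp add: add_ac)
qed

text \<open>
  Here \<open>\<sigma>\<close> is the largest value of the digits in the factors \<open>3, \<dots>, d\<close>, and \<open>n ^ (d - 1) + \<sigma>\<close> the largest
  value of those in the factors \<open>2, \<dots>, d\<close>. The values of \<open>e\<close> are positive and at most
  \<open>R - 1 - (n ^ (d - 1) + \<sigma>)\<close>, so that adding digits of the factors \<open>2, \<dots>, d\<close> to them never reaches \<open>R\<close>.
  They stay off the \<open>n\<close> intervals of length \<open>\<sigma> + 1\<close> that begin at the values of the first digit, so that
  subtracting them from a sum that contains the first digit never gives \<open>0\<close>. With the given \<open>R\<close>, there
  remain at least \<open>n ^ d \<ge> N\<close> admissible exponents. Wherever divisibility is used,
  the total exponent is less than \<open>R\<close> in absolute value, so it is divisible by \<open>R\<close> only if it vanishes.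
\<close>

lemma border_rank_direct_sum_le_cyclic:
  fixes d n N \<sigma> R :: nat
  assumes d: "d \<ge> 2" and n: "n \<ge> 1" and N: "N \<le> n ^ d"
    and \<sigma>: "\<sigma> = (\<Sum>p\<in>{3..d}. n * n ^ (d - p))"
    and R: "R = n ^ d + n ^ (d - 1) + (n + 1) * (\<sigma> + 1)"
  shows "border_rank (d + 1) (sum_indices (V_indices d n) (W_indices N))
    (direct_sum (d + 1) (V_indices d n) (W_indices N) (T1 d n) (T2 d N)) \<le> R"
proof -
  obtain e where e: "inj_on e {1..N}" "\<And>j. j \<in> {1..N} \<Longrightarrow> 1 \<le> e j"
    "\<And>j. j \<in> {1..N} \<Longrightarrow> e j \<le> n ^ d + n * (\<sigma> + 1)"
    "\<And>j i. j \<in> {1..N} \<Longrightarrow> i \<in> {1..n} \<Longrightarrow> e j \<notin> {i * n ^ (d - 1)..i * n ^ (d - 1) + \<sigma>}"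
    using exponents_avoiding_intervals[OF N, of n \<sigma> "\<lambda>i. i * n ^ (d - 1)"] by blast
  define X where "X = cyclic_exponent d n e"
  define W where "W = degeneration_weight d R e"
  let ?I = "sum_indices (V_indices d n) (W_indices N)"
  have XInl: "X p (Inl [i]) = int (i * n ^ (d - p))" if "p \<le> d" for p i
    using that by (simp add: X_def cyclic_exponent_def)
  have XInl_last: "X (d + 1) (Inl l) = - int (\<Sum>q\<in>{1..d}. l ! (q - 1) * n ^ (d - q))" for l
    by (simp add: X_def cyclic_exponent_def)
  have XInr: "X 1 (Inr j) = int (e j)" "X 2 (Inr j) = - int (e j)" "p \<ge> 3 \<Longrightarrow> X p (Inr j) = 0" for j p
    by (simp_all add: X_def cyclic_exponent_def)
  have WInl: "W p (Inl l) = 0" for p l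
    by (simp add: W_def degeneration_weight_def)
  have WInr: "W 1 (Inr j) = 2 * int R - 2 * int (e j)" "W 2 (Inr j) = 2 * int R + 2 * int (e j)"
    "W (d + 1) (Inr j) = - (4 * int R + int (d - 2))" "p \<in> {3..d} \<Longrightarrow> W p (Inr j) = 1" for j p
    using d by (simp_all add: W_def degeneration_weight_def)
  have R_split: "R = (n ^ d + n * (\<sigma> + 1)) + (n ^ (d - 1) + \<sigma>) + 1"
    by (simp add: R algebra_simps)
  have pow1: "n * n ^ (d - 1) = n ^ d" and pow2: "n * n ^ (d - 2) = n ^ (d - 1)"
    using d by (auto simp flip: power_Suc simp: Suc_diff_Suc numeral_2_eq_2)
  have val_less: "(\<Sum>p\<in>{1..d}. a p * n ^ (d - p)) < R" if "\<And>p. p \<in> {1..d} \<Longrightarrow> a p \<in> {1..n}" for a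
  proof -
    have "(\<Sum>p\<in>{1..d}. a p * n ^ (d - p)) \<le> (\<Sum>p\<in>{1..d}. n * n ^ (d - p))"
      using that by (intro sum_mono mult_right_mono) auto
    also have "{1..d} = insert 1 (insert 2 {3..d})"
      using d by auto
    then have "(\<Sum>p\<in>{1..d}. n * n ^ (d - p)) = n ^ d + n ^ (d - 1) + \<sigma>"
      by (simp add: \<sigma> pow1[simplified] pow2)
    also have "\<dots> < R"
      by (simp add: R)
    finally show ?thesis .
  qed
  have "border_rank (d + 1) ?I (indicator (sum_support d n N)) \<le> R"
  proof (rule border_rank_cyclic_degeneration[where X = X and W = W])
    show "R > 0"
      by (simp add: R)
  next
    fix m assume "m \<in> sum_support d n N"
    then consider (left) l where "l \<in> tuples d n" "m = (\<lambda>p\<in>{1..d + 1}. Inl (T1_entry d l p))"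
      | (right) j where "j \<in> {1..N}" "m = (\<lambda>p\<in>{1..d + 1}. Inr (T2_entry d j p))"
      unfolding sum_support_def by blast
    then show "int R dvd (\<Sum>p\<in>{1..d + 1}. X p (m p)) \<and> (\<Sum>p\<in>{1..d + 1}. W p (m p)) = 0"
    proof cases
      case left
      have "(\<Sum>p\<in>{1..d}. X p (m p)) = (\<Sum>p\<in>{1..d}. int (l ! (p - 1) * n ^ (d - p)))"
        by (intro sum.cong) (auto simp: left T1_entry_def XInl[simplified])
      moreover have "X (d + 1) (m (d + 1)) = - (\<Sum>p\<in>{1..d}. int (l ! (p - 1) * n ^ (d - p)))"
        unfolding of_nat_sum[symmetric] XInl_last[symmetric] by (simp add: left T1_entry_def)
      ultimately have "(\<Sum>p\<in>{1..d + 1}. X p (m p)) = 0"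
        by simp
      moreover have "(\<Sum>p\<in>{1..d + 1}. W p (m p)) = 0"
        by (intro sum.neutral) (simp add: left WInl)
      ultimately show ?thesis
        by simp
    next
      case right
      have m: "m 1 = Inr j" "m 2 = Inr j" "m (d + 1) = Inr 1" "\<And>p. p \<in> {3..d} \<Longrightarrow> m p = Inr 1"
        using d by (simp_all add: right T2_entry_def)
      have "(\<Sum>p\<in>{3..d}. X p (m p)) = 0"
        by (intro sum.neutral) (simp add: m XInr)
      moreover have "(\<Sum>p\<in>{3..d}. W p (m p)) = int (d - 2)"
        using d by (simp add: m WInr of_nat_diff)
      ultimately show ?thesis
        using d unfolding sum_split_first_two_last[OF d] m XInr(1,2) WInr(1,2,3) by (simp add: XInr)
    qed
  next
    fix m assume m: "m \<in> multi_indices (d + 1) ?I" and notS: "m \<notin> sum_support d n N"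
      and dvd: "int R dvd (\<Sum>p\<in>{1..d + 1}. X p (m p))"
    have ext: "m \<in> extensional {1..d + 1}"
      using m by (auto simp: multi_indices_def PiE_def)
    have low: "(\<exists>i\<in>{1..n}. m p = Inl [i]) \<or> (\<exists>j. m p = Inr j \<and> (p \<le> 2 \<longrightarrow> j \<in> {1..N}) \<and> (p > 2 \<longrightarrow> j = 1))"
      if "p \<in> {1..d}" for p
      using multi_indices_mem[OF m, of p] that by (auto simp: sum_indices_def V_indices_def W_indices_def split: if_splits)
    have last: "(\<exists>l\<in>tuples d n. m (d + 1) = Inl l) \<or> m (d + 1) = Inr 1"
      using multi_indices_mem[OF m, of "d + 1"] d by (auto simp: sum_indices_def V_indices_def W_indices_def)
    have e_less: "int (e j) < int R" if "j \<in> {1..N}" for j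
      using e(3)[OF that] R_split by linarith
    \<comment> \<open>In a middle factor, a digit contributes at least \<open>1\<close> to \<open>s\<close>, and a vector of \<open>W\<^sub>p\<close> contributes \<open>1\<close> to \<open>c\<close>;
      hence \<open>s + c \<ge> d - 2\<close>, and \<open>s = 0\<close> only if all middle factors are in \<open>W\<^sub>p\<close>.\<close>
    define s where "s = (\<Sum>p\<in>{3..d}. X p (m p))"
    define c where "c = (\<Sum>p\<in>{3..d}. W p (m p))"
    have mid: "X p (m p) \<ge> 0 \<and> X p (m p) \<le> int (n * n ^ (d - p)) \<and> X p (m p) + W p (m p) \<ge> 1
        \<and> W p (m p) \<ge> 0 \<and> (X p (m p) = 0 \<longrightarrow> m p = Inr 1)" if p: "p \<in> {3..d}" for p
    proof -
      consider i where "i \<in> {1..n}" "m p = Inl [i]" | "m p = Inr 1"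
        using low[of p] p by auto
      then show ?thesis
      proof cases
        case 1
        have "i * n ^ (d - p) \<ge> 1" "i * n ^ (d - p) \<le> n * n ^ (d - p)"
          using 1(1) n by (auto intro!: mult_right_mono)
        then have "int (i * n ^ (d - p)) \<ge> 1" "int (i * n ^ (d - p)) \<le> int (n * n ^ (d - p))"
          by linarith+
        then show ?thesis
          using p n unfolding 1(2) by (simp add: XInl WInl del: of_nat_mult)
      qed (use p in \<open>simp add: XInr WInr\<close>)
    qed
    have s0: "s \<ge> 0"
      unfolding s_def using mid by (intro sum_nonneg) auto
    have s\<sigma>: "s \<le> int \<sigma>"
      unfolding s_def \<sigma> of_nat_sum using mid by (intro sum_mono) auto
    have c0: "c \<ge> 0"
      unfolding c_def using mid by (intro sum_nonneg) auto
    have "(\<Sum>p\<in>{3..d}. 1) \<le> s + c"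
      unfolding s_def c_def sum.distrib[symmetric] using mid by (intro sum_mono) auto
    then have sc: "s + c \<ge> int (d - 2)"
      using d by (simp add: of_nat_diff)
    have sumX: "(\<Sum>p\<in>{1..d + 1}. X p (m p)) = X 1 (m 1) + X 2 (m 2) + s + X (d + 1) (m (d + 1))"
      unfolding s_def by (rule sum_split_first_two_last[OF d])
    have sumW: "(\<Sum>p\<in>{1..d + 1}. W p (m p)) = W 1 (m 1) + W 2 (m 2) + c + W (d + 1) (m (d + 1))"
      unfolding c_def by (rule sum_split_first_two_last[OF d])
    have small: "x = 0" if "int R dvd x" "\<bar>x\<bar> < int R" for x :: int
      using that dvd_imp_le_int by force
    show "(\<Sum>p\<in>{1..d + 1}. W p (m p)) > 0"
    proof (cases "m (d + 1) = Inr 1")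
      case False
      then obtain l where l: "l \<in> tuples d n" "m (d + 1) = Inl l"
        using last by blast
      have nonneg: "W p (m p) \<ge> 0 \<and> (W p (m p) = 0 \<longrightarrow> (\<exists>i\<in>{1..n}. m p = Inl [i]))" if p: "p \<in> {1..d}" for p
      proof -
        consider i where "i \<in> {1..n}" "m p = Inl [i]" | j where "j \<in> {1..N}" "p \<le> 2" "m p = Inr j"
          | "p \<in> {3..d}" "m p = Inr 1"
          using low[OF p] p by (cases "p \<le> 2") auto
        then show ?thesis
        proof cases
          case 2
          have "p = 1 \<or> p = 2"
            using 2 p by auto
          then show ?thesis
            using e_less[OF 2(1)] unfolding 2(3) by (auto simp: WInr[simplified])
        qed (auto simp: WInl WInr)
      qed
      have "(\<Sum>p\<in>{1..d}. W p (m p)) \<noteq> 0"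
      proof
        assume "(\<Sum>p\<in>{1..d}. W p (m p)) = 0"
        then have "\<forall>p\<in>{1..d}. W p (m p) = 0"
          using nonneg by (subst (asm) sum_nonneg_eq_0_iff) auto
        then have "\<forall>p\<in>{1..d}. \<exists>i. i \<in> {1..n} \<and> m p = Inl [i]"
          using nonneg by blast
        then obtain a where a: "\<And>p. p \<in> {1..d} \<Longrightarrow> a p \<in> {1..n}" "\<And>p. p \<in> {1..d} \<Longrightarrow> m p = Inl [a p]"
          by metis
        have b: "l ! (p - 1) \<in> {1..n}" if "p \<in> {1..d}" for p
          using tuples_nth[OF l(1) that] .
        let ?a = "\<Sum>p\<in>{1..d}. a p * n ^ (d - p)" and ?b = "\<Sum>p\<in>{1..d}. l ! (p - 1) * n ^ (d - p)"
        have "(\<Sum>p\<in>{1..d}. X p (m p)) = int ?a"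
          unfolding of_nat_sum by (intro sum.cong) (auto simp: a XInl[simplified])
        then have "(\<Sum>p\<in>{1..d + 1}. X p (m p)) = int ?a - int ?b"
          using l(2) XInl_last[of l] by simp
        then have "int R dvd int ?a - int ?b"
          using dvd by argo
        moreover have "\<bar>int ?a - int ?b\<bar> < int R"
          using val_less[of a, OF a(1)] val_less[of "\<lambda>p. l ! (p - 1)", OF b] by linarith
        ultimately have "int ?a - int ?b = 0"
          by (rule small)
        then have "?a = ?b"
          by linarith
        then have eq: "a p = l ! (p - 1)" if "p \<in> {1..d}" for p
          using bijective_base_unique[of d a n "\<lambda>p. l ! (p - 1)" p] a(1) b that by blast
        have "m = (\<lambda>p\<in>{1..d + 1}. Inl (T1_entry d l p))"
        proof (rule extensionalityI[OF ext])
          fix p assume "p \<in> {1..d + 1}"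
          then show "m p = (\<lambda>p\<in>{1..d + 1}. Inl (T1_entry d l p)) p"
            using a(2)[of p] eq[of p] l(2) by (cases "p = d + 1") (auto simp: T1_entry_def)
        qed simp
        then show False
          using notS l(1) unfolding sum_support_def by blast
      qed
      moreover have "(\<Sum>p\<in>{1..d}. W p (m p)) \<ge> 0"
        using nonneg by (intro sum_nonneg) auto
      ultimately show ?thesis
        using l(2) by (simp add: WInl)
    next
      case True
      have lastX: "X (d + 1) (m (d + 1)) = 0"
        using True d by (simp add: XInr)
      have Inl1: "1 \<le> X 1 (Inl [i]) \<and> X 1 (Inl [i]) \<le> int (n ^ d) \<and> X 1 (Inl [i]) = int (i * n ^ (d - 1))"
        if "i \<in> {1..n}" for i
      proof -
        have "1 \<le> i * n ^ (d - 1)" "i * n ^ (d - 1) \<le> n ^ d"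
          using that n mult_right_mono[of i n "n ^ (d - 1)"] by (auto simp: pow1[simplified])
        then show ?thesis
          using XInl[of 1 i] d by linarith
      qed
      have Inl2: "0 \<le> X 2 (Inl [i]) \<and> X 2 (Inl [i]) \<le> int (n ^ (d - 1))" if "i \<in> {1..n}" for i
      proof -
        have "i * n ^ (d - 2) \<le> n ^ (d - 1)"
          using that n mult_right_mono[of i n "n ^ (d - 2)"] by (simp add: pow2)
        then show ?thesis
          using XInl[of 2 i] d by linarith
      qed
      have Rint: "int R = int (n ^ d) + int (n * (\<sigma> + 1)) + int (n ^ (d - 1)) + int \<sigma> + 1"
        using R_split by linarith
      have zero: "X 1 (m 1) + X 2 (m 2) + s = 0" if "\<bar>X 1 (m 1) + X 2 (m 2) + s\<bar> < int R"
        using dvd that unfolding sumX lastX by (intro small) auto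
      have eint: "1 \<le> int (e j) \<and> int (e j) \<le> int (n ^ d) + int (n * (\<sigma> + 1))" if "j \<in> {1..N}" for j
        using e(2,3)[OF that] by linarith
      have one: "(\<exists>i\<in>{1..n}. m 1 = Inl [i]) \<or> (\<exists>j\<in>{1..N}. m 1 = Inr j)"
        using low[of 1] d by auto
      have two: "(\<exists>i\<in>{1..n}. m 2 = Inl [i]) \<or> (\<exists>j\<in>{1..N}. m 2 = Inr j)"
        using low[of 2] d by auto
      have pos: "int (n * (\<sigma> + 1)) \<ge> 0" "int (n ^ (d - 1)) \<ge> 0" "int (n ^ d) \<ge> 0"
        by simp_all
      from one two consider
          (VV) i i' where "i \<in> {1..n}" "i' \<in> {1..n}" "m 1 = Inl [i]" "m 2 = Inl [i']"
        | (VW) i j where "i \<in> {1..n}" "j \<in> {1..N}" "m 1 = Inl [i]" "m 2 = Inr j"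
        | (WV) i j where "i \<in> {1..n}" "j \<in> {1..N}" "m 1 = Inr j" "m 2 = Inl [i]"
        | (WW) j j' where "j \<in> {1..N}" "j' \<in> {1..N}" "m 1 = Inr j" "m 2 = Inr j'"
        by blast
      then show ?thesis
      proof cases
        case VV
        have False
          using zero Inl1[OF VV(1)] Inl2[OF VV(2)] s0 s\<sigma> Rint pos unfolding VV(3,4) by linarith
        then show ?thesis ..
      next
        case VW
        have "X 1 (Inl [i]) - int (e j) + s = 0"
          using zero Inl1[OF VW(1)] eint[OF VW(2)] s0 s\<sigma> Rint pos unfolding VW(3,4) XInr by linarith
        then have "e j \<in> {i * n ^ (d - 1)..i * n ^ (d - 1) + \<sigma>}"
          using Inl1[OF VW(1)] s0 s\<sigma> unfolding atLeastAtMost_iff by linarith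
        then show ?thesis
          using e(4)[OF VW(2,1)] by blast
      next
        case WV
        have False
          using zero Inl2[OF WV(1)] eint[OF WV(2)] s0 s\<sigma> Rint pos unfolding WV(3,4) XInr by linarith
        then show ?thesis ..
      next
        case WW
        have es: "int (e j') = int (e j) + s"
          using zero eint[OF WW(1)] eint[OF WW(2)] s0 s\<sigma> Rint pos unfolding WW(3,4) XInr by linarith
        have "s \<noteq> 0"
        proof
          assume "s = 0"
          then have "j' = j"
            using es e(1) WW(1,2) by (auto dest: inj_onD)
          have "\<forall>p\<in>{3..d}. X p (m p) = 0"
            using \<open>s = 0\<close> mid unfolding s_def by (subst (asm) sum_nonneg_eq_0_iff) auto
          then have mid0: "m p = Inr 1" if "p \<in> {3..d}" for p
            using mid that by blast
          have "m = (\<lambda>p\<in>{1..d + 1}. Inr (T2_entry d j p))"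
          proof (rule extensionalityI[OF ext])
            fix p assume p: "p \<in> {1..d + 1}"
            then consider "p = 1" | "p = 2" | "p \<in> {3..d}" | "p = d + 1"
              by fastforce
            then show "m p = (\<lambda>p\<in>{1..d + 1}. Inr (T2_entry d j p)) p"
              using p WW(3,4) \<open>j' = j\<close> True mid0[of p] d by cases (auto simp: T2_entry_def)
          qed simp
          then show False
            using notS WW(1) unfolding sum_support_def by blast
        qed
        \<comment> \<open>The first two weights add up to \<open>4 * R + 2 * s\<close>, since \<open>e j' = e j + s\<close>. As
          \<open>s + c \<ge> d - 2\<close>, the total weight is at least \<open>s\<close>.\<close>
        have "(\<Sum>p\<in>{1..d + 1}. W p (m p)) = 2 * s + c - int (d - 2)"
          unfolding sumW True WW(3,4) WInr(1,2,3) using es by simp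
        then show ?thesis
          using \<open>s \<noteq> 0\<close> s0 sc by linarith
      qed
    qed
  qed simp
  then show ?thesis
    by (simp only: direct_sum_eq_indicator)
qed

section \<open>The numerical bound\<close>

text \<open>
  The sum on the left is \<open>n + n ^ 2 + \<dots> + n ^ D\<close>; passing from \<open>D\<close> to \<open>D + 1\<close> adds \<open>1\<close> to it and
  multiplies by \<open>n\<close>.
\<close>

lemma cyclic_bound_arith:
  fixes n D :: nat
  assumes n: "n \<ge> 2" and "D \<ge> 1"
  shows "(n + 1) * ((\<Sum>p\<in>{3..D + 2}. n * n ^ (D + 2 - p)) + 1)
    \<le> n ^ (D + 1) + n\<^sup>2 * (n + 1) ^ (D - 1) + 1"
  using assms(2)
proof (induction D rule: dec_induct)
  case base
  have "n + n \<le> n * n"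
    using mult_le_mono1[OF n, of n] by linarith
  then show ?case
    by (simp add: numeral_3_eq_3 power2_eq_square)
next
  case (step D)
  let ?\<sigma> = "\<lambda>D. \<Sum>p\<in>{3..D + 2}. n * n ^ (D + 2 - p)"
  have "?\<sigma> (Suc D) = n * ?\<sigma> D + n"
  proof -
    have "{3..Suc D + 2} = insert (D + 3) {3..D + 2}"
      by auto
    then have "?\<sigma> (Suc D) = (\<Sum>p\<in>{3..D + 2}. n * n ^ (Suc D + 2 - p)) + n"
      by simp
    also have "(\<Sum>p\<in>{3..D + 2}. n * n ^ (Suc D + 2 - p)) = (\<Sum>p\<in>{3..D + 2}. n * (n * n ^ (D + 2 - p)))"
      by (intro sum.cong) (auto simp: Suc_diff_le)
    finally show ?thesis
      unfolding sum_distrib_left .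
  qed
  then have "(n + 1) * (?\<sigma> (Suc D) + 1) = n * ((n + 1) * (?\<sigma> D + 1)) + n + 1"
    by (simp add: algebra_simps)
  also have "\<dots> \<le> n * (n ^ (D + 1) + n\<^sup>2 * (n + 1) ^ (D - 1) + 1) + n + 1"
    using step.IH by (intro add_mono mult_left_mono) auto
  also have "\<dots> = n ^ (D + 2) + n * (n\<^sup>2 * (n + 1) ^ (D - 1)) + 2 * n + 1"
    by (simp add: algebra_simps)
  also have "\<dots> \<le> n ^ (D + 2) + n * (n\<^sup>2 * (n + 1) ^ (D - 1)) + n\<^sup>2 * (n + 1) ^ (D - 1) + 1"
  proof -
    have "2 * n \<le> n\<^sup>2 * 1"
      using mult_le_mono1[OF n, of n] by (simp add: power2_eq_square)
    also have "\<dots> \<le> n\<^sup>2 * (n + 1) ^ (D - 1)"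
      by (intro mult_left_mono) auto
    finally show ?thesis
      by simp
  qed
  also have "\<dots> = n ^ (Suc D + 1) + n\<^sup>2 * (n + 1) ^ (Suc D - 1) + 1"
    using step.hyps by (cases D) (auto simp: algebra_simps)
  finally show ?case .
qed

text \<open>
  For \<open>n \<le> 1\<close> the sum of the two ranks is already small enough.
\<close>

lemma border_rank_direct_sum_le:
  assumes d: "d \<ge> 2" and N: "N \<le> n ^ d"
  shows "real (border_rank (d + 1) (sum_indices (V_indices d n) (W_indices N))
        (direct_sum (d + 1) (V_indices d n) (W_indices N) (T1 d n) (T2 d N)))
      \<le> real n ^ d + 2 * real n ^ (d - 1) + real n ^ 2 * (real n + 1) powi (int d - 3) + 1"
    (is "real ?b \<le> _")
proof (cases "n \<ge> 2")
  case False
  have "?b \<le> n ^ d + N"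
    by (rule border_rank_direct_sum_le_add)
  moreover have "n ^ d \<le> 2 * n ^ (d - 1)"
    using False d by (cases "n = 0") (auto simp: not_le less_Suc_eq numeral_2_eq_2 power_0_left)
  ultimately have "?b \<le> n ^ d + 2 * n ^ (d - 1)"
    using N by linarith
  then have "real ?b \<le> real (n ^ d + 2 * n ^ (d - 1))"
    by (rule of_nat_mono)
  then have "real ?b \<le> real n ^ d + 2 * real n ^ (d - 1)"
    by simp
  moreover have "0 \<le> real n ^ 2 * (real n + 1) powi (int d - 3)"
    by simp
  ultimately show ?thesis
    by linarith
next
  case True
  define \<sigma> where "\<sigma> = (\<Sum>p\<in>{3..d}. n * n ^ (d - p))"
  have "?b \<le> n ^ d + n ^ (d - 1) + (n + 1) * (\<sigma> + 1)"
    using True by (intro border_rank_direct_sum_le_cyclic[OF d _ N \<sigma>_def refl]) simp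
  then have b: "real ?b \<le> real (n ^ d + n ^ (d - 1) + (n + 1) * (\<sigma> + 1))"
    by (rule of_nat_mono)
  show ?thesis
  proof (cases "d = 2")
    case True
    have eq: "n ^ d + n ^ (d - 1) + (n + 1) * (\<sigma> + 1) = n ^ d + 2 * n ^ (d - 1) + 1"
      using True by (simp add: \<sigma>_def)
    have "real ?b \<le> real n ^ d + 2 * real n ^ (d - 1) + 1"
      using b unfolding eq by simp
    moreover have "0 \<le> real n ^ 2 * (real n + 1) powi (int d - 3)"
      by simp
    ultimately show ?thesis
      by linarith
  next
    case False
    define D where "D = d - 2"
    have D: "d = D + 2" "D \<ge> 1"
      using d False by (auto simp: D_def)
    have "(n + 1) * (\<sigma> + 1) \<le> n ^ (D + 1) + n\<^sup>2 * (n + 1) ^ (D - 1) + 1"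
      using cyclic_bound_arith[OF True D(2)] by (simp add: \<sigma>_def D(1))
    then have "real ((n + 1) * (\<sigma> + 1)) \<le> real (n ^ (D + 1) + n\<^sup>2 * (n + 1) ^ (D - 1) + 1)"
      by (rule of_nat_mono)
    moreover have "(real n + 1) powi (int d - 3) = (real n + 1) ^ (D - 1)"
    proof -
      have "int d - 3 = int (D - 1)"
        using D by (simp add: of_nat_diff)
      then show ?thesis
        by simp
    qed
    ultimately show ?thesis
      using b D by (simp add: algebra_simps)
  qed
qed

lemma bound_asymptotics:
  assumes d: "d \<ge> 2"
  shows "(\<lambda>n::nat. (real n ^ d + 2 * real n ^ (d - 1)
        + real n ^ 2 * (real n + 1) powi (int d - 3) + 1) - real n ^ d)
      \<in> O(\<lambda>n. real n ^ (d - 1))"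
proof (rule bigoI[where c = "3 + 2 ^ d"])
  have bound: "real n ^ 2 * (real n + 1) powi (int d - 3) \<le> 2 ^ d * real n ^ (d - 1)" if n: "n \<ge> 1" for n
  proof (cases "d = 2")
    case True
    have "real n ^ 2 / (real n + 1) \<le> 4 * real n"
      using n by (simp add: field_simps power2_eq_square)
    then show ?thesis
      using True by (simp add: power_int_minus divide_inverse)
  next
    case False
    define D where "D = d - 3"
    have D: "d = D + 3"
      using d False by (simp add: D_def)
    have "(real n + 1) ^ D \<le> (2 * real n) ^ D"
      using n by (intro power_mono) auto
    also have "\<dots> \<le> 2 ^ d * real n ^ D"
      by (simp add: D power_mult_distrib mult_right_mono)
    finally have "real n ^ 2 * (real n + 1) ^ D \<le> real n ^ 2 * (2 ^ d * real n ^ D)"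
      by (rule mult_left_mono) simp
    then show ?thesis
      by (simp add: D power_add power2_eq_square mult_ac)
  qed
  have "norm ((real n ^ d + 2 * real n ^ (d - 1)
        + real n ^ 2 * (real n + 1) powi (int d - 3) + 1) - real n ^ d)
      \<le> (3 + 2 ^ d) * norm (real n ^ (d - 1))" if n: "n \<ge> 1" for n
  proof -
    have "1 \<le> real n ^ (d - 1)"
      using n by simp
    moreover have "0 \<le> real n ^ 2 * (real n + 1) powi (int d - 3)"
      by simp
    ultimately show ?thesis
      using bound[OF n] by (simp add: algebra_simps)
  qed
  then show "\<forall>\<^sub>F n in sequentially. norm ((real n ^ d + 2 * real n ^ (d - 1)
        + real n ^ 2 * (real n + 1) powi (int d - 3) + 1) - real n ^ d)
      \<le> (3 + 2 ^ d) * norm (real n ^ (d - 1))"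
    by (rule eventually_sequentiallyI)
qed

theorem theorem3p3:
  fixes n N d :: nat
  assumes "d \<ge> 2" and "N \<le> n ^ d"
  shows "border_rank (d + 1) (V_indices d n) (T1 d n) = n ^ d \<and>
    border_rank (d + 1) (W_indices N) (T2 d N) = N \<and>
    real (border_rank (d + 1) (sum_indices (V_indices d n) (W_indices N))
        (direct_sum (d + 1) (V_indices d n) (W_indices N) (T1 d n) (T2 d N)))
      \<le> real n ^ d + 2 * real n ^ (d - 1) + real n ^ 2 * (real n + 1) powi (int d - 3) + 1 \<and>
    (\<lambda>n::nat. (real n ^ d + 2 * real n ^ (d - 1)
        + real n ^ 2 * (real n + 1) powi (int d - 3) + 1) - real n ^ d)
      \<in> O(\<lambda>n. real n ^ (d - 1))"
  using border_rank_T1 border_rank_T2 border_rank_direct_sum_le bound_asymptotics assms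
  by (intro conjI) auto

end
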